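(* Let $J\in\mathbb{C}^{n\times n}$ be nonsingular, let $C=J^{-T}J$, and let $\Lambda(C)$ be the set of eigenvalues of $C$. For each $\lambda\in\Lambda(C)$ let $r_1,\dots,r_m$ (with $m$ and the $r_j$ depending on $\lambda$) be the sizes of the Jordan blocks of $C$ corresponding to $\lambda$. For $j=1,\dots,m$ select Jordan chain matrices $W_\lambda^{(j)},U_\lambda^{(j)}\in\mathbb{C}^{n\times r_j}$ of $C$ and $C^{-1}$ respectively, corresponding to the eigenvalue $\lambda$. Then the sets $$B_T^+(J)=\bigcup_{\lambda\in\Lambda(C)}\Big(\bigcup_{1\le s,t\le m}\ \bigcup_{k=1}^{\min(r_s,r_t)}\big\{X_T(k,J,W_\lambda^{(s)},U_\lambda^{(t)})\big\}\Big),$$ $$B_T^-(J)=\bigcup_{\lambda\in\Lambda(C)}\Big(\bigcup_{1\le s,t\le m}\ \bigcup_{k=1}^{\min(r_s,r_t)}\big\{Y_T(k,J,W_\lambda^{(s)},U_\lambda^{(t)})\big\}\Big)$$ span the complex vector spaces $\operatorname{sol}(J)=\{X\in\mathbb{C}^{n\times n}:X^TJ+JX=0\}$ and $\operatorname{cosol}(J)=\{X\in\mathbb{C}^{n\times n}:X^TJ-JX=0\}$, respectively.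
   Context: $J^{-T}=(J^T)^{-1}$. $J_r^\lambda$ is the $r\times r$ upper triangular Jordan block with eigenvalue $\lambda$ (ones on the superdiagonal). For a matrix $A$ and eigenvalue $\lambda$ with Jordan blocks of sizes $r_1,\dots,r_m$, Jordan chain matrices of $A$ corresponding to $\lambda$ are matrices $W^{(j)}\in\mathbb{C}^{n\times r_j}$, $j=1,\dots,m$, one for each Jordan block, whose columns are the generalized eigenvector chains, so that $AW^{(j)}=W^{(j)}J_{r_j}^\lambda$; all their columns together form a basis of the generalized eigenspace of $A$ for $\lambda$. (The matrices $C$ and $C^{-1}$ are similar, so they have the same Jordan block sizes for $\lambda$.) $E_j$ is the $j\times j$ backwards identity (ones on the antidiagonal, zeros elsewhere). For $j\le\min(s,t)$, $E_j^{s,t}$ is the $s\times t$ matrix that is zero except that its upper left $j\times j$ corner is $E_j$. For $W\in\mathbb{C}^{n\times a}$, $U\in\mathbb{C}^{n\times b}$ and $k=1,\dots,\min(a,b)$, $X_T(k,J,W,U)=WE_k^{a,b}U^TJ^T-UE_k^{b,a}W^TJ$ and $Y_T(k,J,W,U)=WE_k^{a,b}U^TJ^T+UE_k^{b,a}W^TJ$. *)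

theory Defs
  imports "Jordan_Normal_Form.Spectral_Radius" "Jordan_Normal_Form.Matrix_Kernel"
begin

text \<open>
  Complex matrices are elements of the type \<^typ>\<open>complex mat\<close>, with rows and columns numbered from 0;
  linear spans are taken in the complex vector space \<^term>\<open>module_mat TYPE(complex) n n\<close>.
\<close>

text \<open>
  The library inverse \<^const>\<open>mat_inverse\<close> is an option; the value below is meaningful
  only for invertible matrices (see the lemma).
\<close>

definition mat_inv :: "complex mat \<Rightarrow> complex mat" where
  "mat_inv A = the (mat_inverse A)"

lemma mat_inv:
  assumes A: "A \<in> carrier_mat n n" and inv: "invertible_mat A"
  shows "mat_inv A \<in> carrier_mat n n" "A * mat_inv A = 1\<^sub>m n" "mat_inv A * A = 1\<^sub>m n"
proof -
  from inv obtain B where AB: "A * B = 1\<^sub>m n" and BA: "B * A = 1\<^sub>m (dim_row B)"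
    using A unfolding invertible_mat_def inverts_mat_def by auto
  from arg_cong[OF AB, of dim_col] arg_cong[OF BA, of dim_col] A
  have B: "B \<in> carrier_mat n n" by auto
  have "A \<in> Units (ring_mat TYPE(complex) n ())"
    unfolding Units_def ring_mat_simps using A B AB BA by auto
  then obtain C where C: "mat_inverse A = Some C"
    using mat_inverse(1)[OF A, where b = "()"] by (cases "mat_inverse A") blast+
  with mat_inverse(2)[OF A C]
  show "mat_inv A \<in> carrier_mat n n" "A * mat_inv A = 1\<^sub>m n" "mat_inv A * A = 1\<^sub>m n"
    unfolding mat_inv_def by auto
qed

definition cosquare :: "complex mat \<Rightarrow> complex mat" where
  "cosquare J = mat_inv (J\<^sup>T) * J"

text \<open>
  \<open>rs\<close> enumerates, with multiplicity and in some order, the sizes of the Jordan blocks of \<open>A\<close>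
  with eigenvalue \<open>l\<close>. The Jordan matrix in \<^const>\<open>jordan_nf\<close> may list its blocks in any order.
\<close>

definition jordan_block_sizes :: "complex mat \<Rightarrow> complex \<Rightarrow> nat list \<Rightarrow> bool" where
  "jordan_block_sizes A l rs \<longleftrightarrow>
     (\<exists>bs. jordan_nf A bs \<and> rs = map fst (filter (\<lambda>(r, \<mu>). \<mu> = l) bs))"

text \<open>Here \<^term>\<open>char_matrix A l\<close> is the matrix \<open>A - l I\<close>.\<close>

definition gen_eigenspace :: "complex mat \<Rightarrow> complex \<Rightarrow> complex vec set" where
  "gen_eigenspace A l = (\<Union>k. mat_kernel (char_matrix A l ^\<^sub>m k))"

text \<open>
  Distinctness is required separately because a basis is a set in the library, while
  the columns of the chain matrices are to form a basis as a family.
\<close>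

definition jordan_chain_matrices ::
  "complex mat \<Rightarrow> complex \<Rightarrow> nat list \<Rightarrow> complex mat list \<Rightarrow> bool" where
  "jordan_chain_matrices A l rs Ws \<longleftrightarrow>
     length Ws = length rs \<and>
     (\<forall>j < length rs. Ws ! j \<in> carrier_mat (dim_row A) (rs ! j) \<and>
        A * Ws ! j = Ws ! j * jordan_block (rs ! j) l) \<and>
     distinct (concat (map cols Ws)) \<and>
     vectorspace.basis class_ring
       (module_vec TYPE(complex) (dim_row A) \<lparr>carrier := gen_eigenspace A l\<rparr>)
       (set (concat (map cols Ws)))"

definition backward_id :: "nat \<Rightarrow> complex mat" where
  "backward_id k = mat k k (\<lambda>(p, q). if p + q + 1 = k then 1 else 0)"

definition backward_id_corner :: "nat \<Rightarrow> nat \<Rightarrow> nat \<Rightarrow> complex mat" where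
  "backward_id_corner k a b =
     mat a b (\<lambda>(p, q). if p < k \<and> q < k then backward_id k $$ (p, q) else 0)"

definition X_T :: "nat \<Rightarrow> complex mat \<Rightarrow> complex mat \<Rightarrow> complex mat \<Rightarrow> complex mat" where
  "X_T k J W U =
     W * backward_id_corner k (dim_col W) (dim_col U) * U\<^sup>T * J\<^sup>T
     - U * backward_id_corner k (dim_col U) (dim_col W) * W\<^sup>T * J"

definition Y_T :: "nat \<Rightarrow> complex mat \<Rightarrow> complex mat \<Rightarrow> complex mat \<Rightarrow> complex mat" where
  "Y_T k J W U =
     W * backward_id_corner k (dim_col W) (dim_col U) * U\<^sup>T * J\<^sup>T
     + U * backward_id_corner k (dim_col U) (dim_col W) * W\<^sup>T * J"

definition sol :: "complex mat \<Rightarrow> complex mat set" where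
  "sol J = {X \<in> carrier_mat (dim_row J) (dim_row J).
     X\<^sup>T * J + J * X = 0\<^sub>m (dim_row J) (dim_row J)}"

definition cosol :: "complex mat \<Rightarrow> complex mat set" where
  "cosol J = {X \<in> carrier_mat (dim_row J) (dim_row J).
     X\<^sup>T * J - J * X = 0\<^sub>m (dim_row J) (dim_row J)}"

definition B_T_plus ::
  "complex mat \<Rightarrow> (complex \<Rightarrow> nat list) \<Rightarrow> (complex \<Rightarrow> complex mat list) \<Rightarrow>
   (complex \<Rightarrow> complex mat list) \<Rightarrow> complex mat set" where
  "B_T_plus J r W U =
     (\<Union>l \<in> spectrum (cosquare J).
       \<Union>s < length (r l). \<Union>t < length (r l).
       \<Union>k \<in> {1..min (r l ! s) (r l ! t)}. {X_T k J (W l ! s) (U l ! t)})"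

definition B_T_minus ::
  "complex mat \<Rightarrow> (complex \<Rightarrow> nat list) \<Rightarrow> (complex \<Rightarrow> complex mat list) \<Rightarrow>
   (complex \<Rightarrow> complex mat list) \<Rightarrow> complex mat set" where
  "B_T_minus J r W U =
     (\<Union>l \<in> spectrum (cosquare J).
       \<Union>s < length (r l). \<Union>t < length (r l).
       \<Union>k \<in> {1..min (r l ! s) (r l ! t)}. {Y_T k J (W l ! s) (U l ! t)})"

end

theory Submission
  imports Defs
begin

text \<open>
  Let \<open>\<sigma>\<close> be \<open>1\<close> or \<open>-1\<close>, and let \<open>\<tau> P = P J\<^sup>T - \<sigma> P\<^sup>T J\<close>. For the two signs \<open>\<tau>\<close> takes \<open>W E\<^sub>k U\<^sup>T\<close> to \<open>X\<^sub>T\<close>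
  and to \<open>Y\<^sub>T\<close>, and the equation to be solved is \<open>X\<^sup>T J = -\<sigma> J X\<close>. Using this equation together with
  its transpose, one sees that a solution \<open>X\<close> commutes with \<open>C\<close>. Equivalently, \<open>P = X J\<^sup>-\<^sup>T\<close> satisfies
  \<open>C P = P (C\<^sup>-\<^sup>1)\<^sup>T\<close>, and \<open>\<tau> P = 2 X\<close>. Conversely \<open>\<tau>\<close> maps every \<open>P\<close> with this property to a
  solution (\<open>twisted_sol_eq_image\<close>). As \<open>\<tau>\<close> is linear, both parts of the theorem follow once the
  matrices \<open>W E\<^sub>k U\<^sup>T\<close> are known to span the space of all \<open>P\<close> with \<open>C P = P (C\<^sup>-\<^sup>1)\<^sup>T\<close>.

  This is a fact about any two matrices \<open>A\<close> and \<open>B\<close> with the same Jordan structure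
  (\<open>corner_product_sylvester\<close> and \<open>sylvester_solution_expansion\<close>). In coordinates given by chain
  vectors of \<open>A\<close> and of \<open>B\<close>, the equation \<open>A Y = Y B\<^sup>T\<close> reads, for each pair of chains,
  \<open>l M p q + M (p + 1) q = m M p q + M p (q + 1)\<close>, where \<open>M\<close> is zero outside the block. If \<open>l\<close> and \<open>m\<close>
  differ, then the block vanishes. If they agree, then it is constant along antidiagonals and zero
  beyond the shorter side, hence a combination of the matrices \<open>E\<^sub>k\<close>.

  The coordinates exist because all chain vectors together form a basis: generalized eigenspaces
  for distinct eigenvalues are independent (\<open>chain_vectors_independent\<close>), and the block sizes add
  up to \<open>n\<close> (\<open>card_chain_indices\<close>).
\<close>

section \<open>Generalized eigenspaces\<close>

lemma gen_eigenspace_iff: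
  assumes "A \<in> carrier_mat n n"
  shows "x \<in> gen_eigenspace A l \<longleftrightarrow>
    x \<in> carrier_vec n \<and> (\<exists>k. (char_matrix A l ^\<^sub>m k) *\<^sub>v x = 0\<^sub>v n)"
proof -
  have "char_matrix A l ^\<^sub>m k \<in> carrier_mat n n" for k
    using assms by (intro pow_carrier_mat) auto
  then show ?thesis
    unfolding gen_eigenspace_def by (auto simp: mat_kernel[of _ n n])
qed

lemma pow_mat_commute:
  fixes N B :: "'a :: comm_ring_1 mat"
  assumes N: "N \<in> carrier_mat n n" and B: "B \<in> carrier_mat n n" and NB: "N * B = B * N"
  shows "(N ^\<^sub>m k) * B = B * (N ^\<^sub>m k)"
proof (induction k)
  case 0
  then show ?case using assms by simp
next
  case (Suc k)
  have Nk: "N ^\<^sub>m k \<in> carrier_mat n n" using N by (rule pow_carrier_mat)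
  have "(N ^\<^sub>m Suc k) * B = (N ^\<^sub>m k) * (B * N)"
    using assoc_mult_mat[OF Nk N B] NB by simp
  also have "\<dots> = B * (N ^\<^sub>m k) * N"
    using assoc_mult_mat[OF Nk B N] Suc.IH by simp
  also have "\<dots> = B * (N ^\<^sub>m Suc k)"
    using assoc_mult_mat[OF B Nk N] by simp
  finally show ?case .
qed

lemma mult_mat_zero_vec:
  fixes A :: "'a :: semiring_0 mat"
  assumes "A \<in> carrier_mat nr nc"
  shows "A *\<^sub>v 0\<^sub>v nc = 0\<^sub>v nr"
  using assms by (intro eq_vecI) auto

lemma gen_eigenspace_invariant:
  assumes A: "A \<in> carrier_mat n n" and B: "B \<in> carrier_mat n n"
    and AB: "char_matrix A l * B = B * char_matrix A l"
    and x: "x \<in> gen_eigenspace A l"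
  shows "B *\<^sub>v x \<in> gen_eigenspace A l"
proof -
  obtain k where xc: "x \<in> carrier_vec n" and k: "(char_matrix A l ^\<^sub>m k) *\<^sub>v x = 0\<^sub>v n"
    using x gen_eigenspace_iff[OF A] by auto
  have N: "char_matrix A l \<in> carrier_mat n n" using A by simp
  have Nk: "char_matrix A l ^\<^sub>m k \<in> carrier_mat n n" using N by (rule pow_carrier_mat)
  have "(char_matrix A l ^\<^sub>m k) *\<^sub>v (B *\<^sub>v x) = B *\<^sub>v ((char_matrix A l ^\<^sub>m k) *\<^sub>v x)"
    using pow_mat_commute[OF N B AB, of k] assoc_mult_mat_vec[OF Nk B xc]
      assoc_mult_mat_vec[OF B Nk xc] by simp
  also have "\<dots> = 0\<^sub>v n" using k mult_mat_zero_vec[OF B] by simp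
  finally show ?thesis using gen_eigenspace_iff[OF A] B xc by auto
qed

lemma char_matrix_commute:
  assumes "A \<in> carrier_mat n n"
  shows "char_matrix A l * char_matrix A m = char_matrix A m * char_matrix A l"
proof -
  have *: "char_matrix A l * char_matrix A m
    = (A * A + (- m) \<cdot>\<^sub>m A) + ((- l) \<cdot>\<^sub>m A + (l * m) \<cdot>\<^sub>m 1\<^sub>m n)" for l m
  proof -
    have "char_matrix A l * char_matrix A m
      = A * (A + (- m) \<cdot>\<^sub>m 1\<^sub>m n) + ((- l) \<cdot>\<^sub>m 1\<^sub>m n) * (A + (- m) \<cdot>\<^sub>m 1\<^sub>m n)"
      using assms unfolding char_matrix_def by (simp add: add_mult_distrib_mat[where nr = n and nc = n])
    also have "A * (A + (- m) \<cdot>\<^sub>m 1\<^sub>m n) = A * A + (- m) \<cdot>\<^sub>m A"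
      using assms by (simp add: mult_add_distrib_mat[where nr = n and nc = n and n = n]
          mult_smult_distrib[where nr = n and nc = n and n = n])
    also have "((- l) \<cdot>\<^sub>m 1\<^sub>m n) * (A + (- m) \<cdot>\<^sub>m 1\<^sub>m n) = (- l) \<cdot>\<^sub>m (A + (- m) \<cdot>\<^sub>m 1\<^sub>m n)"
      using assms by (simp add: mult_smult_assoc_mat[where nr = n and n = n and nc = n])
    also have "\<dots> = (- l) \<cdot>\<^sub>m A + (l * m) \<cdot>\<^sub>m 1\<^sub>m n"
      using assms by (intro eq_matI) (auto simp: algebra_simps)
    finally show ?thesis .
  qed
  show ?thesis unfolding * using assms by (intro eq_matI) (auto simp: algebra_simps)
qed

lemma char_matrix_mult_vec:
  assumes A: "A \<in> carrier_mat n n" and x: "x \<in> carrier_vec n"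
  shows "char_matrix A l *\<^sub>v x = A *\<^sub>v x - l \<cdot>\<^sub>v x"
  using assms unfolding char_matrix_def
  by (intro eq_vecI) (auto simp: add_mult_distrib_mat_vec[where nr = n and nc = n])

lemma char_matrix_pow_eigenvector:
  assumes A: "A \<in> carrier_mat n n" and x: "x \<in> carrier_vec n" and ev: "A *\<^sub>v x = l \<cdot>\<^sub>v x"
  shows "(char_matrix A m ^\<^sub>m k) *\<^sub>v x = ((l - m) ^ k) \<cdot>\<^sub>v x"
proof (induction k)
  case 0
  then show ?case using A x by (simp add: char_matrix_def)
next
  case (Suc k)
  have N: "char_matrix A m \<in> carrier_mat n n" using A by simp
  have Nk: "char_matrix A m ^\<^sub>m k \<in> carrier_mat n n" using N by (rule pow_carrier_mat)
  have "char_matrix A m *\<^sub>v x = (l - m) \<cdot>\<^sub>v x"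
    using x unfolding char_matrix_mult_vec[OF A x] ev by (intro eq_vecI) (auto simp: algebra_simps)
  then have "(char_matrix A m ^\<^sub>m Suc k) *\<^sub>v x = (l - m) \<cdot>\<^sub>v (((l - m) ^ k) \<cdot>\<^sub>v x)"
    using assoc_mult_mat_vec[OF Nk N x] mult_mat_vec[OF Nk x] Suc.IH by simp
  then show ?case by (simp add: smult_smult_assoc)
qed

text \<open>
  Induction on the exponent that kills \<open>x\<close>: the vector \<open>(A - l I) x\<close> is killed by a smaller power
  and still lies in the generalized eigenspace for \<open>m\<close>, hence is zero.
\<close>

lemma gen_eigenspace_disjoint:
  assumes A: "A \<in> carrier_mat n n" and lm: "l \<noteq> m"
    and xl: "x \<in> gen_eigenspace A l" and xm: "x \<in> gen_eigenspace A m"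
  shows "x = 0\<^sub>v n"
proof -
  have Nl: "char_matrix A l \<in> carrier_mat n n" using A by simp
  have "x = 0\<^sub>v n" if "(char_matrix A l ^\<^sub>m k) *\<^sub>v x = 0\<^sub>v n" "x \<in> gen_eigenspace A m" for k x
    using that
  proof (induction k arbitrary: x)
    case 0
    then show ?case using A gen_eigenspace_iff[OF A] by (simp add: char_matrix_def)
  next
    case (Suc k)
    from Suc.prems(2) have x: "x \<in> carrier_vec n" using gen_eigenspace_iff[OF A] by simp
    have "(char_matrix A l ^\<^sub>m k) *\<^sub>v (char_matrix A l *\<^sub>v x) = 0\<^sub>v n"
      using Suc.prems(1) assoc_mult_mat_vec[OF pow_carrier_mat[OF Nl] Nl x] by simp
    moreover have "char_matrix A l *\<^sub>v x \<in> gen_eigenspace A m"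
      by (intro gen_eigenspace_invariant[OF A Nl] char_matrix_commute[OF A] Suc.prems)
    ultimately have "A *\<^sub>v x - l \<cdot>\<^sub>v x = 0\<^sub>v n"
      using Suc.IH char_matrix_mult_vec[OF A x] by metis
    \<comment> \<open>So \<open>x\<close> is zero or an eigenvector for \<open>l\<close>, and \<open>A - m I\<close> scales it by \<open>l - m\<close>.\<close>
    then have "(A *\<^sub>v x - l \<cdot>\<^sub>v x) $ i = 0" if "i < n" for i
      using that by simp
    then have ev: "A *\<^sub>v x = l \<cdot>\<^sub>v x"
      using A x by (intro eq_vecI) auto
    obtain K where "(char_matrix A m ^\<^sub>m K) *\<^sub>v x = 0\<^sub>v n"
      using Suc.prems(2) gen_eigenspace_iff[OF A] by auto
    then have *: "((l - m) ^ K) \<cdot>\<^sub>v x = 0\<^sub>v n"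
      using char_matrix_pow_eigenvector[OF A x ev] by simp
    have "x $ i = 0" if "i < n" for i
    proof -
      have "(((l - m) ^ K) \<cdot>\<^sub>v x) $ i = 0" unfolding * using that by simp
      then show ?thesis using that x lm by simp
    qed
    then show ?case using x by (intro eq_vecI) auto
  qed
  then show ?thesis using xl xm gen_eigenspace_iff[OF A] by blast
qed

lemma gen_eigenspace_submodule:
  assumes A: "A \<in> carrier_mat n n"
  shows "submodule class_ring (gen_eigenspace A l) (module_vec TYPE(complex) n)"
proof -
  let ?N = "char_matrix A l"
  have N: "?N \<in> carrier_mat n n" using A by simp
  have Nk: "?N ^\<^sub>m k \<in> carrier_mat n n" for k using N by (rule pow_carrier_mat)
  have mono: "(?N ^\<^sub>m (k + j)) *\<^sub>v x = 0\<^sub>v n"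
    if x: "x \<in> carrier_vec n" and "(?N ^\<^sub>m k) *\<^sub>v x = 0\<^sub>v n" for x k j
    using that(2)
  proof (induction j)
    case (Suc j)
    have "?N ^\<^sub>m (k + Suc j) = ?N * ?N ^\<^sub>m (k + j)"
      using pow_mat_commute[OF N N refl, of "k + j"] by simp
    then show ?case using assoc_mult_mat_vec[OF N Nk x] Suc mult_mat_zero_vec[OF N] by simp
  qed simp
  have add: "v + w \<in> gen_eigenspace A l" if v: "v \<in> gen_eigenspace A l" and w: "w \<in> gen_eigenspace A l" for v w
  proof -
    obtain j k where jk: "(?N ^\<^sub>m j) *\<^sub>v v = 0\<^sub>v n" "(?N ^\<^sub>m k) *\<^sub>v w = 0\<^sub>v n"
      and vw: "v \<in> carrier_vec n" "w \<in> carrier_vec n"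
      using v w gen_eigenspace_iff[OF A] by auto
    have "(?N ^\<^sub>m (j + k)) *\<^sub>v (v + w) = 0\<^sub>v n"
      using mult_add_distrib_mat_vec[OF Nk vw] mono[OF vw(1) jk(1), of k] mono[OF vw(2) jk(2), of j]
      by (simp add: add.commute)
    then show ?thesis unfolding gen_eigenspace_iff[OF A] using vw by auto
  qed
  have smult: "c \<cdot>\<^sub>v v \<in> gen_eigenspace A l" if v: "v \<in> gen_eigenspace A l" for c v
  proof -
    obtain j where "(?N ^\<^sub>m j) *\<^sub>v v = 0\<^sub>v n" and vc: "v \<in> carrier_vec n"
      using v gen_eigenspace_iff[OF A] by auto
    then have "(?N ^\<^sub>m j) *\<^sub>v (c \<cdot>\<^sub>v v) = 0\<^sub>v n" using mult_mat_vec[OF Nk vc] by (intro eq_vecI) auto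
    then show ?thesis unfolding gen_eigenspace_iff[OF A] using vc by auto
  qed
  have zero: "0\<^sub>v n \<in> gen_eigenspace A l"
    using gen_eigenspace_iff[OF A] Nk[of 0] by (intro iffD2[OF gen_eigenspace_iff[OF A]] conjI exI[of _ 0]) auto
  show ?thesis
    by (intro submodule.intro)
       (use vec_module zero add smult gen_eigenspace_iff[OF A] in \<open>auto simp: module_vec_simps\<close>)
qed

lemma gen_eigenspace_sum:
  assumes A: "A \<in> carrier_mat n n" and "finite I" and "\<And>x. x \<in> I \<Longrightarrow> w x \<in> gen_eigenspace A l"
  shows "vec n (\<lambda>i. \<Sum>x\<in>I. c x * w x $ i) \<in> gen_eigenspace A l"
  using assms(2,3)
proof (induction I)
  case empty
  have "vec n (\<lambda>i. 0 :: complex) = 0\<^sub>v n" by auto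
  then show ?case using submodule.zero_closed[OF gen_eigenspace_submodule[OF A]]
    by (simp add: module_vec_simps)
next
  case (insert y I)
  note sub = gen_eigenspace_submodule[OF A, of l]
  have y: "w y \<in> gen_eigenspace A l" using insert by simp
  then have yc: "w y \<in> carrier_vec n" using gen_eigenspace_iff[OF A] by simp
  have "vec n (\<lambda>i. \<Sum>x\<in>insert y I. c x * w x $ i) = c y \<cdot>\<^sub>v w y + vec n (\<lambda>i. \<Sum>x\<in>I. c x * w x $ i)"
    using insert yc by (intro eq_vecI) auto
  also have "\<dots> \<in> gen_eigenspace A l"
    using submodule.m_closed[OF sub] submodule.smult_closed[OF sub] y insert
    by (simp add: module_vec_simps)
  finally show ?case .
qed

text \<open>
  A power of \<open>A - k I\<close> removes the summand for \<open>k\<close> from a vanishing sum and leaves each other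
  summand in its own generalized eigenspace, so the induction hypothesis applies to what remains.
\<close>

lemma gen_eigenspaces_independent:
  assumes A: "A \<in> carrier_mat n n" and "finite S"
    and "\<And>l. l \<in> S \<Longrightarrow> x l \<in> gen_eigenspace A l"
    and "\<And>i. i < n \<Longrightarrow> (\<Sum>l\<in>S. x l $ i) = 0"
    and "m \<in> S"
  shows "x m = 0\<^sub>v n"
  using assms(2-)
proof (induction S arbitrary: x m)
  case empty
  then show ?case by simp
next
  case (insert k S)
  have xc: "x l \<in> carrier_vec n" if "l \<in> insert k S" for l
    using insert.prems(1)[OF that] gen_eigenspace_iff[OF A] by simp
  have "x k \<in> gen_eigenspace A k" using insert.prems(1) by simp
  then obtain K where K: "(char_matrix A k ^\<^sub>m K) *\<^sub>v x k = 0\<^sub>v n"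
    using gen_eigenspace_iff[OF A] by auto
  define B where "B = char_matrix A k ^\<^sub>m K"
  have N: "char_matrix A k \<in> carrier_mat n n" using A by simp
  then have B: "B \<in> carrier_mat n n" unfolding B_def by (rule pow_carrier_mat)
  have AB: "char_matrix A l * B = B * char_matrix A l" for l
    unfolding B_def using pow_mat_commute[OF N _ char_matrix_commute[OF A]] A by simp
  have "B *\<^sub>v x l = 0\<^sub>v n" if l: "l \<in> S" for l
  proof (rule insert.IH[where x = "\<lambda>l. B *\<^sub>v x l"])
    show "B *\<^sub>v x l \<in> gen_eigenspace A l" if "l \<in> S" for l
      using that insert.prems(1) by (intro gen_eigenspace_invariant[OF A B AB]) simp
    fix i assume i: "i < n"
    have Bx: "(B *\<^sub>v x l) $ i = (\<Sum>j<n. B $$ (i, j) * x l $ j)" if "l \<in> insert k S" for l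
      using xc[OF that] B i by (auto simp: scalar_prod_def atLeast0LessThan)
    have "(\<Sum>l\<in>insert k S. (B *\<^sub>v x l) $ i) = (\<Sum>j<n. B $$ (i, j) * (\<Sum>l\<in>insert k S. x l $ j))"
      by (simp add: Bx sum_distrib_left del: sum.insert) (rule sum.swap)
    also have "\<dots> = 0" using insert.prems(2) by simp
    finally show "(\<Sum>l\<in>S. (B *\<^sub>v x l) $ i) = 0"
      using insert.hyps K i unfolding B_def by simp
  qed (fact l)
  then have S0: "x l = 0\<^sub>v n" if l: "l \<in> S" for l
    using l xc[of l] insert.hyps insert.prems(1) gen_eigenspace_iff[OF A]
    unfolding B_def by (intro gen_eigenspace_disjoint[OF A, of l k]) auto
  have "x k $ i = 0" if "i < n" for i
    using insert.prems(2)[OF that] insert.hyps S0 that by simp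
  then have "x k = 0\<^sub>v n" using xc[of k] by (intro eq_vecI) auto
  then show ?case using S0 insert.prems(3) by auto
qed

section \<open>The chain vectors form a basis\<close>

text \<open>
  The index \<open>(l, s, p)\<close> stands for column \<open>p\<close> of the \<open>s\<close>-th chain matrix for \<open>l\<close>. Vectors are
  treated as families over these triples rather than as sets, since all later arguments move along
  a chain by changing \<open>p\<close>.
\<close>

definition chain_indices ::
  "complex set \<Rightarrow> (complex \<Rightarrow> nat list) \<Rightarrow> (complex \<times> nat \<times> nat) set" where
  "chain_indices S r = (SIGMA l:S. SIGMA s:{..<length (r l)}. {..<r l ! s})"

fun chain_vector :: "(complex \<Rightarrow> complex mat list) \<Rightarrow> complex \<times> nat \<times> nat \<Rightarrow> complex vec" where
  "chain_vector W (l, s, p) = col (W l ! s) p"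

lemma mem_chain_indices [simp]:
  "(l, s, p) \<in> chain_indices S r \<longleftrightarrow> l \<in> S \<and> s < length (r l) \<and> p < r l ! s"
  by (auto simp: chain_indices_def)

lemma finite_chain_indices [simp]: "finite S \<Longrightarrow> finite (chain_indices S r)"
  unfolding chain_indices_def by (intro finite_SigmaI) auto

lemma sum_chain_indices:
  assumes "finite S"
  shows "(\<Sum>x\<in>chain_indices S r. f x) = (\<Sum>l\<in>S. \<Sum>s<length (r l). \<Sum>p<r l ! s. f (l, s, p))"
  unfolding chain_indices_def using assms by (simp add: sum.Sigma split_def)

lemma sum_list_split_by_label:
  fixes bs :: "(nat \<times> 'a) list"
  assumes "finite S" and "snd ` set bs \<subseteq> S"
  shows "(\<Sum>l\<in>S. sum_list (map fst (filter (\<lambda>b. snd b = l) bs))) = sum_list (map fst bs)"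
  using assms(2)
proof (induction bs)
  case (Cons b bs)
  have "(\<Sum>l\<in>S. sum_list (map fst (filter (\<lambda>b. snd b = l) (b # bs))))
    = (\<Sum>l\<in>S. (if snd b = l then fst b else 0) + sum_list (map fst (filter (\<lambda>b. snd b = l) bs)))"
    by (intro sum.cong) auto
  also have "\<dots> = (\<Sum>l\<in>S. if snd b = l then fst b else 0) + sum_list (map fst bs)"
    using Cons by (simp add: sum.distrib)
  also have "(\<Sum>l\<in>S. if snd b = l then fst b else 0) = fst b"
    using assms(1) Cons.prems by (simp add: sum.delta')
  finally show ?case by simp
qed simp

text \<open>
  The block sizes for \<open>l\<close> add up to the algebraic multiplicity of \<open>l\<close>, whichever Jordan form
  they are read off from. Hence they can all be taken from one fixed Jordan form, whose
  characteristic polynomial has degree \<open>n\<close>.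
\<close>

lemma card_chain_indices:
  assumes C: "C \<in> carrier_mat n n"
    and r: "\<And>l. l \<in> spectrum C \<Longrightarrow> jordan_block_sizes C l (r l)"
  shows "card (chain_indices (spectrum C) r) = n"
proof -
  have fin: "finite (spectrum C)" using card_finite_spectrum[OF C] by simp
  obtain as where "char_poly C = (\<Prod>a\<leftarrow>as. [:- a, 1:])"
    using char_poly_factorized[OF C] by blast
  then obtain bs where bs: "jordan_nf C bs" using jordan_nf_exists[OF C] by blast
  have size: "sum_list (r l) = sum_list (map fst (filter (\<lambda>b. snd b = l) bs))" if l: "l \<in> spectrum C" for l
  proof -
    obtain cs where "jordan_nf C cs" and "r l = map fst (filter (\<lambda>(r, \<mu>). \<mu> = l) cs)"
      using r[OF l] unfolding jordan_block_sizes_def by blast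
    then have "sum_list (r l) = Polynomial.order l (char_poly C)"
      using jordan_nf_order[of C cs l] by (simp add: split_def)
    then show ?thesis using jordan_nf_order[OF bs, of l] by simp
  qed
  have cp: "char_poly C = (\<Prod>(k, a)\<leftarrow>bs. [:- a, 1:] ^ k)"
    by (rule jordan_nf_char_poly[OF bs])
  have sub: "snd ` set bs \<subseteq> spectrum C"
  proof
    fix l assume "l \<in> snd ` set bs"
    then obtain k where k: "(k, l) \<in> set bs" by auto
    then have "k \<noteq> 0" using bs unfolding jordan_nf_def by force
    have "poly (char_poly C) l = (\<Prod>(k, a)\<leftarrow>bs. (l - a) ^ k)"
      unfolding cp poly_prod_list by (simp add: o_def split_def)
    also have "\<dots> = 0"
      using k \<open>k \<noteq> 0\<close> unfolding prod_list_zero_iff by (force simp: image_iff)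
    finally show "l \<in> spectrum C"
      using eigenvalue_root_char_poly[OF C] unfolding spectrum_def by simp
  qed
  have deg: "degree (\<Prod>(k, a)\<leftarrow>bs. [:- a, 1:] ^ k) = sum_list (map fst bs)" for bs :: "(nat \<times> complex) list"
  proof (induction bs)
    case (Cons b bs)
    have "(\<Prod>(k, a)\<leftarrow>bs. [:- a, 1:] ^ k) \<noteq> (0 :: complex poly)"
      by (auto simp: prod_list_zero_iff)
    then have "degree ([:- snd b, 1:] ^ fst b * (\<Prod>(k, a)\<leftarrow>bs. [:- a, 1:] ^ k))
      = fst b + degree (\<Prod>(k, a)\<leftarrow>bs. [:- a, 1:] ^ k)"
      by (subst degree_mult_eq) (auto simp: degree_power_eq)
    then show ?case using Cons by (simp add: split_def)
  qed simp
  have "card (chain_indices (spectrum C) r) = (\<Sum>l\<in>spectrum C. sum_list (r l))"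
    unfolding chain_indices_def using fin
    by (simp add: card_SigmaI sum_list_sum_nth atLeast0LessThan)
  also have "\<dots> = sum_list (map fst bs)"
    using size sum_list_split_by_label[OF fin sub] by simp
  also have "\<dots> = n" using deg[of bs] degree_monic_char_poly[OF C] cp by simp
  finally show ?thesis .
qed

lemma jordan_chain_matrices_dim:
  assumes "A \<in> carrier_mat n n" and "jordan_chain_matrices A l rs Ws" and "s < length rs"
  shows "Ws ! s \<in> carrier_mat n (rs ! s)"
  using assms unfolding jordan_chain_matrices_def by simp

lemma chain_vector_carrier:
  assumes "A \<in> carrier_mat n n" and "\<And>l. l \<in> S \<Longrightarrow> jordan_chain_matrices A l (r l) (W l)"
    and "x \<in> chain_indices S r"
  shows "chain_vector W x \<in> carrier_vec n"
  using assms jordan_chain_matrices_dim[of A n] by (cases x) fastforce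

lemma mult_jordan_block_col:
  fixes W :: "'a :: comm_ring_1 mat"
  assumes W: "W \<in> carrier_mat n k" and "p < k"
  shows "col (W * jordan_block k l) p
    = l \<cdot>\<^sub>v col W p + (case p of 0 \<Rightarrow> 0\<^sub>v n | Suc q \<Rightarrow> col W q)"
proof (rule eq_vecI)
  fix i assume "i < dim_vec (l \<cdot>\<^sub>v col W p + (case p of 0 \<Rightarrow> 0\<^sub>v n | Suc q \<Rightarrow> col W q))"
  then have i: "i < n" using W by (auto split: nat.splits)
  have "col (W * jordan_block k l) p $ i
    = (\<Sum>q<k. W $$ (i, q) * (if q = p then l else if Suc q = p then 1 else 0))"
    using i W \<open>p < k\<close> by (simp add: scalar_prod_def atLeast0LessThan)
  also have "\<dots> = (\<Sum>q<k. (if q = p then l * W $$ (i, q) else 0))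
      + (\<Sum>q<k. if Suc q = p then W $$ (i, q) else 0)"
    unfolding sum.distrib[symmetric] by (intro sum.cong) auto
  also have "\<dots> = (l \<cdot>\<^sub>v col W p + (case p of 0 \<Rightarrow> 0\<^sub>v n | Suc q \<Rightarrow> col W q)) $ i"
    using i W \<open>p < k\<close> by (cases p) (auto simp: mult.commute)
  finally show "col (W * jordan_block k l) p $ i
    = (l \<cdot>\<^sub>v col W p + (case p of 0 \<Rightarrow> 0\<^sub>v n | Suc q \<Rightarrow> col W q)) $ i" .
qed (use W in \<open>auto split: nat.splits\<close>)

lemma chain_vector_step:
  assumes A: "A \<in> carrier_mat n n" and ch: "jordan_chain_matrices A l (r l) (W l)"
    and "s < length (r l)" and "p < r l ! s"
  shows "A *\<^sub>v chain_vector W (l, s, p) = l \<cdot>\<^sub>v chain_vector W (l, s, p)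
    + (case p of 0 \<Rightarrow> 0\<^sub>v n | Suc q \<Rightarrow> chain_vector W (l, s, q))"
proof -
  have W: "W l ! s \<in> carrier_mat n (r l ! s)"
    and AW: "A * W l ! s = W l ! s * jordan_block (r l ! s) l"
    using ch assms(3) A unfolding jordan_chain_matrices_def by auto
  have "A *\<^sub>v col (W l ! s) p = col (A * W l ! s) p"
    using A W assms(4) by (intro eq_vecI) auto
  then show ?thesis
    unfolding AW using mult_jordan_block_col[OF W assms(4)] by (simp split: nat.splits)
qed

text \<open>
  Applied to lists of columns: distinctness makes the indexing by \<open>(s, p)\<close> injective, so that independence of
  the set of columns is independence of the indexed family.
\<close>

lemma distinct_concat_nth_eq:
  assumes "distinct (concat xss)" and "i < length xss" "p < length (xss ! i)"
    and "j < length xss" "q < length (xss ! j)" and "xss ! i ! p = xss ! j ! q"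
  shows "i = j \<and> p = q"
  using assms
proof (induction xss arbitrary: i j)
  case (Cons xs xss)
  then show ?case using Cons
    by (cases i; cases j) (simp_all add: nth_eq_iff_index_eq disjoint_iff, (metis nth_mem)+)
qed simp

text \<open>
  The basis property is stated inside the generalized eigenspace. Linear dependence does not change
  when it is read in the ambient space, where it can be tested coordinate by coordinate.
\<close>

lemma jordan_chain_columns:
  assumes A: "A \<in> carrier_mat n n" and ch: "jordan_chain_matrices A l rs Ws"
  shows "set (concat (map cols Ws)) \<subseteq> gen_eigenspace A l"
    and "\<not> module.lin_dep class_ring (module_vec TYPE(complex) n) (set (concat (map cols Ws)))"
proof -
  let ?V = "module_vec TYPE(complex) n"
  let ?B = "set (concat (map cols Ws))"
  interpret vec_module "TYPE(complex)" n .
  have bas: "vectorspace.basis class_ring (?V\<lparr>carrier := gen_eigenspace A l\<rparr>) ?B"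
    using ch A unfolding jordan_chain_matrices_def by auto
  have sub: "submodule class_ring (gen_eigenspace A l) ?V"
    by (rule gen_eigenspace_submodule[OF A])
  have vs: "vectorspace class_ring (?V\<lparr>carrier := gen_eigenspace A l\<rparr>)"
    using submodule_is_module[OF sub] class_field by (simp add: vectorspace_def)
  show BE: "?B \<subseteq> gen_eigenspace A l"
    using bas unfolding vectorspace.basis_def[OF vs] by simp
  show "\<not> lin_dep ?B"
    using bas span_li_not_depend(2)[OF BE sub] unfolding vectorspace.basis_def[OF vs] by simp
qed

lemma col_in_concat_cols:
  assumes "s < length Ws" and "p < dim_col (Ws ! s)"
  shows "col (Ws ! s) p \<in> set (concat (map cols Ws))"
proof -
  have "col (Ws ! s) p \<in> set (cols (Ws ! s))" using assms by (simp add: cols_def)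
  then show ?thesis using assms(1) by auto
qed

lemma jordan_chain_independent:
  assumes A: "A \<in> carrier_mat n n" and ch: "jordan_chain_matrices A l rs Ws"
    and c: "\<And>i. i < n \<Longrightarrow> (\<Sum>s<length rs. \<Sum>p<rs ! s. c s p * col (Ws ! s) p $ i) = 0"
    and sp: "s < length rs" "p < rs ! s"
  shows "c s p = 0"
proof -
  let ?B = "set (concat (map cols Ws))"
  define I where "I = (SIGMA s:{..<length rs}. {..<rs ! s})"
  define w where "w = (\<lambda>(s, p). col (Ws ! s) p)"
  interpret vec_module "TYPE(complex)" n .
  have len: "length Ws = length rs" and dist: "distinct (concat (map cols Ws))"
    using ch unfolding jordan_chain_matrices_def by auto
  have dim: "Ws ! s \<in> carrier_mat n (rs ! s)" if "s < length rs" for s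
    using jordan_chain_matrices_dim[OF A ch that] .
  note BE = jordan_chain_columns(1)[OF A ch] and li = jordan_chain_columns(2)[OF A ch]
  have Bc: "?B \<subseteq> carrier_vec n" using BE gen_eigenspace_iff[OF A] by auto
  have inj: "inj_on w I"
  proof (rule inj_onI)
    fix x y assume "x \<in> I" "y \<in> I" "w x = w y"
    then show "x = y"
      using distinct_concat_nth_eq[OF dist, of "fst x" "snd x" "fst y" "snd y"] dim len
      unfolding I_def w_def by (force simp: split_def)
  qed
  have "w (s, p) \<in> ?B" if "(s, p) \<in> I" for s p
    using that dim[of s] len col_in_concat_cols[of s Ws p] unfolding I_def w_def by simp
  then have wB: "w ` I \<subseteq> ?B" by auto
  have finI: "finite I" unfolding I_def by (intro finite_SigmaI) auto
  define a where "a = (\<lambda>v. c (fst (inv_into I w v)) (snd (inv_into I w v)))"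
  have aw: "a (w x) = c (fst x) (snd x)" if "x \<in> I" for x
    unfolding a_def using that inj by simp
  have "lincomb a (w ` I) = 0\<^sub>v n"
  proof (rule eq_vecI)
    fix i assume "i < dim_vec (0\<^sub>v n :: complex vec)"
    then have i: "i < n" by simp
    have wc: "w ` I \<subseteq> carrier_vec n" using wB Bc by auto
    have "lincomb a (w ` I) $ i = (\<Sum>v\<in>w ` I. (a v \<cdot>\<^sub>v v) $ i)"
      unfolding lincomb_def using wc i by (intro finsum_index) auto
    also have "\<dots> = (\<Sum>v\<in>w ` I. a v * v $ i)"
      using wc i by (intro sum.cong) auto
    also have "\<dots> = (\<Sum>x\<in>I. c (fst x) (snd x) * w x $ i)"
      using aw by (simp add: sum.reindex[OF inj])
    also have "\<dots> = (\<Sum>s<length rs. \<Sum>p<rs ! s. c s p * col (Ws ! s) p $ i)"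
      unfolding I_def w_def by (simp add: sum.Sigma split_def)
    finally show "lincomb a (w ` I) $ i = 0\<^sub>v n $ i" using c[OF i] i by simp
  next
    show "dim_vec (lincomb a (w ` I)) = dim_vec (0\<^sub>v n :: complex vec)"
      using lincomb_closed[of "w ` I" a] wB Bc by auto
  qed
  then have "a (w (s, p)) = 0"
    using li lin_dep_crit[where A = "w ` I" and S = ?B and a = a and v = "w (s, p)"] finI wB sp unfolding I_def by auto
  then show ?thesis using aw[of "(s, p)"] sp unfolding I_def by simp
qed

text \<open>
  Independence of an indexed family: unlike for the underlying set, a repeated vector counts as a
  dependence.
\<close>

definition independent_vectors :: "nat \<Rightarrow> 'i set \<Rightarrow> ('i \<Rightarrow> 'a :: field vec) \<Rightarrow> bool" where
  "independent_vectors n I w \<longleftrightarrow>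
     (\<forall>c. (\<forall>i<n. (\<Sum>x\<in>I. c x * w x $ i) = 0) \<longrightarrow> (\<forall>x\<in>I. c x = 0))"

text \<open>
  In a vanishing combination the terms for one eigenvalue add up to a vector of its generalized
  eigenspace. These vectors vanish because generalized eigenspaces are independent, and then the
  independence of the columns for a single eigenvalue applies.
\<close>

lemma chain_vectors_independent:
  assumes A: "A \<in> carrier_mat n n" and S: "finite S"
    and ch: "\<And>l. l \<in> S \<Longrightarrow> jordan_chain_matrices A l (r l) (W l)"
  shows "independent_vectors n (chain_indices S r) (chain_vector W)"
  unfolding independent_vectors_def
proof (intro allI impI ballI)
  fix c x
  assume "\<forall>i<n. (\<Sum>x\<in>chain_indices S r. c x * chain_vector W x $ i) = 0"
  then have c: "(\<Sum>x\<in>chain_indices S r. c x * chain_vector W x $ i) = 0" if "i < n" for i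
    using that by simp
  assume x: "x \<in> chain_indices S r"
  obtain m s p where x: "x = (m, s, p)" "m \<in> S" "s < length (r m)" "p < r m ! s"
    using x by (cases x) auto
  define I where "I l = (SIGMA s:{..<length (r l)}. {..<r l ! s})" for l
  define y where "y l = vec n (\<lambda>i. \<Sum>(s, p)\<in>I l. c (l, s, p) * col (W l ! s) p $ i)" for l
  have yi: "y l $ i = (\<Sum>s<length (r l). \<Sum>p<r l ! s. c (l, s, p) * col (W l ! s) p $ i)"
    if "i < n" for l i
    using that unfolding y_def I_def by (simp add: sum.Sigma split_def)
  have ge: "col (W l ! s) p \<in> gen_eigenspace A l" if "l \<in> S" "(s, p) \<in> I l" for l s p
    using that jordan_chain_columns(1)[OF A ch] col_in_concat_cols[of s "W l" p]
      jordan_chain_matrices_dim[OF A ch, of l s] ch[OF that(1)]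
    unfolding I_def jordan_chain_matrices_def by auto
  have "y l \<in> gen_eigenspace A l" if "l \<in> S" for l
  proof -
    have "finite (I l)" unfolding I_def by (intro finite_SigmaI) auto
    from gen_eigenspace_sum[OF A this, of "\<lambda>(s, p). col (W l ! s) p" l "\<lambda>(s, p). c (l, s, p)"]
    show ?thesis using ge[OF that] unfolding y_def by (auto simp: split_def)
  qed
  moreover have "(\<Sum>l\<in>S. y l $ i) = 0" if "i < n" for i
    using c[OF that] yi[OF that] S by (simp add: sum_chain_indices)
  ultimately have "y m = 0\<^sub>v n"
    using gen_eigenspaces_independent[OF A S, of y m] x(2) by blast
  then have "(\<Sum>s<length (r m). \<Sum>p<r m ! s. c (m, s, p) * col (W m ! s) p $ i) = 0" if "i < n" for i
    using yi[OF that, of m] that by simp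
  then show "c x = 0"
    unfolding x(1) using jordan_chain_independent[OF A ch[OF x(2)], of "\<lambda>s p. c (m, s, p)"] x by blast
qed

section \<open>Dual bases and the equation \<open>A Y = Y B\<^sup>T\<close>\<close>

text \<open>
  As many independent vectors as coordinates are the columns of an invertible matrix. The rows of
  its inverse are the dual basis, and the last property expands a vector in the basis. Setting the
  dual vectors to zero outside the index set lets recurrences run past the end of a chain without a
  separate boundary case.
\<close>

lemma dual_family:
  fixes w :: "'i \<Rightarrow> 'a :: field vec"
  assumes I: "finite I" "card I = n" and w: "\<And>x. x \<in> I \<Longrightarrow> w x \<in> carrier_vec n"
    and indep: "independent_vectors n I w"
  obtains a where "\<And>x. a x \<in> carrier_vec n" and "\<And>x. x \<notin> I \<Longrightarrow> a x = 0\<^sub>v n"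
    and "\<And>x y. x \<in> I \<Longrightarrow> y \<in> I \<Longrightarrow> a x \<bullet> w y = (if x = y then 1 else 0)"
    and "\<And>v i. v \<in> carrier_vec n \<Longrightarrow> i < n \<Longrightarrow> v $ i = (\<Sum>x\<in>I. (a x \<bullet> v) * w x $ i)"
proof -
  obtain h where h: "bij_betw h {..<n} I"
    using ex_bij_betw_nat_finite[OF I(1)] I(2) by (auto simp: atLeast0LessThan)
  define g where "g = inv_into {..<n} h"
  have g: "g x < n" "h (g x) = x" if "x \<in> I" for x
    using that h bij_betw_inv_into_right[OF h that] bij_betw_apply[OF bij_betw_inv_into[OF h] that]
    unfolding g_def by auto
  have gh: "g (h k) = k" and hI: "h k \<in> I" if "k < n" for k
    using that bij_betw_inv_into_left[OF h, of k] bij_betw_apply[OF h, of k] unfolding g_def by auto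
  define M where "M = mat n n (\<lambda>(i, k). w (h k) $ i)"
  have M: "M \<in> carrier_mat n n" unfolding M_def by simp
  have colM: "col M k = w (h k)" if "k < n" for k
    using that w[OF hI[OF that]] unfolding M_def by (intro eq_vecI) auto
  have "det M \<noteq> 0"
  proof
    assume "det M = 0"
    then obtain v where v: "v \<in> carrier_vec n" "v \<noteq> 0\<^sub>v n" "M *\<^sub>v v = 0\<^sub>v n"
      using det_0_iff_vec_prod_zero[OF M] by auto
    have "(\<Sum>x\<in>I. v $ g x * w x $ i) = 0" if i: "i < n" for i
    proof -
      have "(\<Sum>y\<in>I. v $ g y * w y $ i) = (\<Sum>k<n. v $ k * w (h k) $ i)"
        using gh by (simp add: sum.reindex_bij_betw[OF h, symmetric])
      also have "\<dots> = (M *\<^sub>v v) $ i"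
        using i v(1) unfolding M_def by (auto simp: scalar_prod_def atLeast0LessThan mult.commute)
      finally show ?thesis using v(3) i by simp
    qed
    then have "v $ g x = 0" if "x \<in> I" for x
      using that indep[unfolded independent_vectors_def, rule_format, of "\<lambda>x. v $ g x" x] by blast
    then have "v $ k = 0" if "k < n" for k using gh[OF that] hI[OF that] by metis
    then have "v = 0\<^sub>v n" using v(1) by (intro eq_vecI) auto
    with v(2) show False by simp
  qed
  then obtain B where B: "B \<in> carrier_mat n n" and MB: "M * B = 1\<^sub>m n" and BM: "B * M = 1\<^sub>m n"
    using det_non_zero_imp_unit[OF M, of "()"] unfolding Units_def ring_mat_def by auto
  define a where "a x = (if x \<in> I then row B (g x) else 0\<^sub>v n)" for x
  show ?thesis
  proof
    show "a x \<in> carrier_vec n" for x using B unfolding a_def by auto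
    show "a x = 0\<^sub>v n" if "x \<notin> I" for x using that unfolding a_def by simp
    show "a x \<bullet> w y = (if x = y then 1 else 0)" if xy: "x \<in> I" "y \<in> I" for x y
    proof -
      have "a x \<bullet> w y = (B * M) $$ (g x, g y)"
        using xy g colM[of "g y"] B M unfolding a_def by simp
      then show ?thesis unfolding BM using g xy by (auto dest: arg_cong[where f = h])
    qed
    show "v $ i = (\<Sum>x\<in>I. (a x \<bullet> v) * w x $ i)" if v: "v \<in> carrier_vec n" and i: "i < n" for v i
    proof -
      have "v $ i = (M *\<^sub>v (B *\<^sub>v v)) $ i"
        using assoc_mult_mat_vec[OF M B v] MB v by simp
      also have "\<dots> = (\<Sum>k<n. (row B k \<bullet> v) * w (h k) $ i)"
        using i M B unfolding M_def by (auto simp: scalar_prod_def atLeast0LessThan mult.commute)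
      also have "\<dots> = (\<Sum>k<n. (a (h k) \<bullet> v) * w (h k) $ i)"
        using gh hI unfolding a_def by simp
      also have "\<dots> = (\<Sum>x\<in>I. (a x \<bullet> v) * w x $ i)"
        by (rule sum.reindex_bij_betw[OF h])
      finally show ?thesis .
    qed
  qed
qed

text \<open>
  Along a chain \<open>A - l I\<close> moves a basis vector to its predecessor, so its transpose moves a dual
  vector to its successor. It is enough to compare the two sides on the basis vectors.
\<close>

lemma dual_chain_step:
  assumes A: "A \<in> carrier_mat n n"
    and ch: "\<And>l. l \<in> S \<Longrightarrow> jordan_chain_matrices A l (r l) (W l)"
    and a: "\<And>x. a x \<in> carrier_vec n" and a0: "\<And>x. x \<notin> chain_indices S r \<Longrightarrow> a x = 0\<^sub>v n"
    and dual: "\<And>x y. x \<in> chain_indices S r \<Longrightarrow> y \<in> chain_indices S r \<Longrightarrow>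
      a x \<bullet> chain_vector W y = (if x = y then 1 else 0)"
    and expand: "\<And>v i. v \<in> carrier_vec n \<Longrightarrow> i < n \<Longrightarrow>
      v $ i = (\<Sum>x\<in>chain_indices S r. (a x \<bullet> v) * chain_vector W x $ i)"
    and x: "(l, s, p) \<in> chain_indices S r"
    and v: "v \<in> carrier_vec n"
  shows "a (l, s, p) \<bullet> (A *\<^sub>v v) = l * (a (l, s, p) \<bullet> v) + a (l, s, Suc p) \<bullet> v"
proof -
  let ?I = "chain_indices S r"
  let ?w = "chain_vector W"
  have w: "?w y \<in> carrier_vec n" if "y \<in> ?I" for y
    using chain_vector_carrier[OF A ch that] .
  have on_basis: "a (l, s, p) \<bullet> (A *\<^sub>v ?w y) = l * (a (l, s, p) \<bullet> ?w y) + a (l, s, Suc p) \<bullet> ?w y"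
    if y: "y \<in> ?I" for y
  proof -
    obtain m t q where [simp]: "y = (m, t, q)" by (cases y)
    have y': "m \<in> S" "t < length (r m)" "q < r m ! t" using y by auto
    have step: "A *\<^sub>v ?w y = m \<cdot>\<^sub>v ?w y + (case q of 0 \<Rightarrow> 0\<^sub>v n | Suc j \<Rightarrow> ?w (m, t, j))"
      using chain_vector_step[where r = r and W = W, OF A ch] y' by simp
    have "a (l, s, Suc p) \<bullet> ?w y = (if (l, s, Suc p) = y then 1 else 0)"
    proof (cases "(l, s, Suc p) \<in> ?I")
      case True
      then show ?thesis by (rule dual[OF _ y])
    next
      case False
      then show ?thesis using a0[OF False] w[OF y] y by auto
    qed
    moreover have "a (l, s, p) \<bullet> (A *\<^sub>v ?w y)
      = m * (if (l, s, p) = y then 1 else 0) + (if (l, s, Suc p) = y then 1 else 0)"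
    proof (cases q)
      case 0
      then show ?thesis using step w[OF y] a[of "(l, s, p)"] dual[OF x y]
        by (auto simp: scalar_prod_smult_distrib[where n = n] simp del: chain_vector.simps)
    next
      case (Suc j)
      have j: "(m, t, j) \<in> ?I" using y' Suc by simp
      have "a (l, s, p) \<bullet> (A *\<^sub>v ?w y)
        = m * (a (l, s, p) \<bullet> ?w y) + a (l, s, p) \<bullet> ?w (m, t, j)"
        using step Suc w[OF y] w[OF j] a[of "(l, s, p)"]
        by (simp add: scalar_prod_add_distrib[where n = n] del: chain_vector.simps)
      then show ?thesis using dual[OF x y] dual[OF x j] Suc by auto
    qed
    ultimately show ?thesis using dual[OF x y] by auto
  qed
  \<comment> \<open>Both sides are linear in \<open>v\<close>: the row vector \<open>z\<close> is their difference.\<close>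
  define z where "z = A\<^sup>T *\<^sub>v a (l, s, p) - l \<cdot>\<^sub>v a (l, s, p) - a (l, s, Suc p)"
  have z: "z \<in> carrier_vec n" using A a unfolding z_def by simp
  have zv: "z \<bullet> v = a (l, s, p) \<bullet> (A *\<^sub>v v) - l * (a (l, s, p) \<bullet> v) - a (l, s, Suc p) \<bullet> v"
    if v: "v \<in> carrier_vec n" for v
    using A a[of "(l, s, p)"] a[of "(l, s, Suc p)"] v unfolding z_def
    by (simp add: minus_scalar_prod_distrib[where n = n] transpose_vec_mult_scalar[OF A v])
  have "z \<bullet> v = (\<Sum>i<n. z $ i * v $ i)"
    using v by (simp add: scalar_prod_def atLeast0LessThan)
  also have "\<dots> = (\<Sum>i<n. z $ i * (\<Sum>x\<in>?I. (a x \<bullet> v) * ?w x $ i))"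
  proof (rule sum.cong[OF refl])
    fix i assume "i \<in> {..<n}"
    then show "z $ i * v $ i = z $ i * (\<Sum>x\<in>?I. (a x \<bullet> v) * ?w x $ i)"
      using arg_cong[OF expand[OF v, of i], of "(*) (z $ i)"] by simp
  qed
  also have "\<dots> = (\<Sum>x\<in>?I. \<Sum>i<n. z $ i * ((a x \<bullet> v) * ?w x $ i))"
    by (simp add: sum_distrib_left) (rule sum.swap)
  also have "\<dots> = (\<Sum>x\<in>?I. (a x \<bullet> v) * (z \<bullet> ?w x))"
  proof (rule sum.cong[OF refl])
    fix x assume "x \<in> ?I"
    from w[OF this] have "z \<bullet> ?w x = (\<Sum>i<n. z $ i * ?w x $ i)"
      by (simp add: scalar_prod_def[of z "?w x"] atLeast0LessThan)
    then show "(\<Sum>i<n. z $ i * ((a x \<bullet> v) * ?w x $ i)) = (a x \<bullet> v) * (z \<bullet> ?w x)"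
      by (simp add: sum_distrib_left mult_ac)
  qed
  also have "\<dots> = 0" using on_basis zv w by simp
  finally show ?thesis using zv[OF v] by (simp add: algebra_simps)
qed

text \<open>
  Here \<open>f p q\<close> is the coefficient of a solution at position \<open>(p, q)\<close> of the block that belongs to
  two chains with eigenvalues \<open>l\<close> and \<open>m\<close>. The recurrence determines it from the coefficients at
  \<open>(p + 1, q)\<close> and \<open>(p, q + 1)\<close>, so zeros propagate inwards from outside the block.
\<close>

lemma sylvester_coefficients_distinct:
  fixes f :: "nat \<Rightarrow> nat \<Rightarrow> 'a :: idom"
  assumes lm: "l \<noteq> m" and rec: "\<And>p q. l * f p q + f (Suc p) q = m * f p q + f p (Suc q)"
    and a: "\<And>p q. p \<ge> a \<Longrightarrow> f p q = 0" and b: "\<And>p q. q \<ge> b \<Longrightarrow> f p q = 0"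
  shows "f p q = 0"
proof (induction "(a - p) + (b - q)" arbitrary: p q rule: less_induct)
  case less
  show ?case
  proof (cases "p \<ge> a \<or> q \<ge> b")
    case True
    then show ?thesis using a b by auto
  next
    case False
    have "f (Suc p) q = 0" by (rule less) (use False in auto)
    moreover have "f p (Suc q) = 0" by (rule less) (use False in auto)
    ultimately have "(l - m) * f p q = 0" using rec[of p q] by (simp add: algebra_simps)
    then show ?thesis using lm by simp
  qed
qed

text \<open>
  For equal eigenvalues the recurrence only says that the block is constant along antidiagonals.
\<close>

lemma hankel_coefficients:
  assumes "\<And>p q. f (Suc p) q = f p (Suc q)"
  shows "f p q = f (p + q) 0"
proof (induction q arbitrary: p)
  case (Suc q)
  then show ?case using assms[of p q] by simp
qed simp

lemma corner_sandwich_index: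
  fixes W U :: "complex mat"
  assumes W: "W \<in> carrier_mat n a" and U: "U \<in> carrier_mat n b" and ij: "i < n" "j < n"
  shows "(W * backward_id_corner k a b * U\<^sup>T) $$ (i, j)
    = (\<Sum>p<a. \<Sum>q<b. W $$ (i, p) * U $$ (j, q) * (if p + q + 1 = k then 1 else 0))"
proof -
  have E: "backward_id_corner k a b \<in> carrier_mat a b" unfolding backward_id_corner_def by simp
  have e: "backward_id_corner k a b $$ (p, q) = (if p + q + 1 = k then 1 else 0)" if "p < a" "q < b" for p q
    using that unfolding backward_id_corner_def backward_id_def by auto
  have "(W * backward_id_corner k a b * U\<^sup>T) $$ (i, j)
    = (\<Sum>q<b. (W * backward_id_corner k a b) $$ (i, q) * U $$ (j, q))"
    using W U E ij by (simp add: scalar_prod_def atLeast0LessThan del: assoc_mult_mat)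
  also have "\<dots> = (\<Sum>q<b. \<Sum>p<a. W $$ (i, p) * U $$ (j, q) * (if p + q + 1 = k then 1 else 0))"
    using W E e ij by (intro sum.cong) (auto simp: scalar_prod_def atLeast0LessThan sum_distrib_right intro!: sum.cong)
  also have "\<dots> = (\<Sum>p<a. \<Sum>q<b. W $$ (i, p) * U $$ (j, q) * (if p + q + 1 = k then 1 else 0))"
    by (rule sum.swap)
  finally show ?thesis .
qed

definition corner_indices :: "complex set \<Rightarrow> (complex \<Rightarrow> nat list) \<Rightarrow> (complex \<times> nat \<times> nat \<times> nat) set" where
  "corner_indices S r =
     (SIGMA l:S. SIGMA s:{..<length (r l)}. SIGMA t:{..<length (r l)}. {1..min (r l ! s) (r l ! t)})"

text \<open>
  The building blocks \<open>W E\<^sub>k U\<^sup>T\<close> of the matrices in the two spanning sets.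
\<close>

fun corner_product :: "(complex \<Rightarrow> complex mat list) \<Rightarrow> (complex \<Rightarrow> complex mat list) \<Rightarrow>
    complex \<times> nat \<times> nat \<times> nat \<Rightarrow> complex mat" where
  "corner_product W U (l, s, t, k) =
     W l ! s * backward_id_corner k (dim_col (W l ! s)) (dim_col (U l ! t)) * (U l ! t)\<^sup>T"

text \<open>
  Expand \<open>Y\<close> as the sum of \<open>M x y\<close> times the products \<open>w\<^sub>x u\<^sub>y\<^sup>T\<close> of chain vectors, with coefficients
  obtained from the two dual bases. Evaluating \<open>A Y = Y B\<^sup>T\<close> between dual vectors turns the equation
  into the recurrence for the coefficients. Blocks of distinct eigenvalues therefore vanish. A block
  of equal eigenvalues is constant along antidiagonals and zero on every antidiagonal that leaves
  the block, and the matrices \<open>E\<^sub>k\<close> are exactly the remaining antidiagonals.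
\<close>

lemma sylvester_solution_expansion:
  assumes A: "A \<in> carrier_mat n n" and B: "B \<in> carrier_mat n n"
    and S: "finite S" and card: "card (chain_indices S r) = n"
    and chA: "\<And>l. l \<in> S \<Longrightarrow> jordan_chain_matrices A l (r l) (W l)"
    and chB: "\<And>l. l \<in> S \<Longrightarrow> jordan_chain_matrices B l (r l) (U l)"
    and Y: "Y \<in> carrier_mat n n" and AY: "A * Y = Y * B\<^sup>T"
  obtains c where "\<And>i j. i < n \<Longrightarrow> j < n \<Longrightarrow>
    Y $$ (i, j) = (\<Sum>x\<in>corner_indices S r. c x * corner_product W U x $$ (i, j))"
proof -
  let ?I = "chain_indices S r"
  let ?w = "chain_vector W"
  let ?u = "chain_vector U"
  have fin: "finite ?I" using S by simp
  have wc: "?w x \<in> carrier_vec n" and uc: "?u x \<in> carrier_vec n" if "x \<in> ?I" for x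
    using chain_vector_carrier[OF A chA that] chain_vector_carrier[OF B chB that] by auto
  obtain a where a: "\<And>x. a x \<in> carrier_vec n" and a0: "\<And>x. x \<notin> ?I \<Longrightarrow> a x = 0\<^sub>v n"
    and ad: "\<And>x y. x \<in> ?I \<Longrightarrow> y \<in> ?I \<Longrightarrow> a x \<bullet> ?w y = (if x = y then 1 else 0)"
    and ae: "\<And>v i. v \<in> carrier_vec n \<Longrightarrow> i < n \<Longrightarrow> v $ i = (\<Sum>x\<in>?I. (a x \<bullet> v) * ?w x $ i)"
    using dual_family[OF fin card wc chain_vectors_independent[OF A S chA]] by blast
  obtain b where b: "\<And>x. b x \<in> carrier_vec n" and b0: "\<And>x. x \<notin> ?I \<Longrightarrow> b x = 0\<^sub>v n"
    and bd: "\<And>x y. x \<in> ?I \<Longrightarrow> y \<in> ?I \<Longrightarrow> b x \<bullet> ?u y = (if x = y then 1 else 0)"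
    and be: "\<And>v i. v \<in> carrier_vec n \<Longrightarrow> i < n \<Longrightarrow> v $ i = (\<Sum>x\<in>?I. (b x \<bullet> v) * ?u x $ i)"
    using dual_family[OF fin card uc chain_vectors_independent[OF B S chB]] by blast
  define M where "M x y = a x \<bullet> (Y *\<^sub>v b y)" for x y
  have M0: "M x y = 0" if "x \<notin> ?I \<or> y \<notin> ?I" for x y
  proof -
    have "Y *\<^sub>v 0\<^sub>v n = 0\<^sub>v n" using mult_mat_zero_vec[OF Y] .
    then show ?thesis using that a0[of x] b0[of y] a[of x] b[of y] Y unfolding M_def by auto
  qed
  have rec: "l * M (l, s, p) (m, t, q) + M (l, s, Suc p) (m, t, q)
      = m * M (l, s, p) (m, t, q) + M (l, s, p) (m, t, Suc q)" for l s p m t q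
  proof (cases "(l, s, p) \<in> ?I \<and> (m, t, q) \<in> ?I")
    case True
    let ?x = "(l, s, p)" and ?y = "(m, t, q)"
    have Yb: "Y *\<^sub>v b z \<in> carrier_vec n" for z using Y b by simp
    have BT: "B\<^sup>T \<in> carrier_mat n n" using B by simp
    have AYb: "A *\<^sub>v (Y *\<^sub>v b ?y) = Y *\<^sub>v (B\<^sup>T *\<^sub>v b ?y)"
      using assoc_mult_mat_vec[OF A Y b] assoc_mult_mat_vec[OF Y BT b] AY by simp
    have Ya: "a ?x \<bullet> (Y *\<^sub>v v) = (Y\<^sup>T *\<^sub>v a ?x) \<bullet> v" if "v \<in> carrier_vec n" for v
      using transpose_vec_mult_scalar[OF Y that a] by simp
    have YTa: "Y\<^sup>T *\<^sub>v a ?x \<in> carrier_vec n" using Y a by simp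
    have "a ?x \<bullet> (A *\<^sub>v (Y *\<^sub>v b ?y)) = l * M ?x ?y + M (l, s, Suc p) ?y"
      unfolding M_def using dual_chain_step[OF A chA a a0 ad ae _ Yb] True by simp
    moreover have "a ?x \<bullet> (Y *\<^sub>v (B\<^sup>T *\<^sub>v b ?y)) = m * M ?x ?y + M ?x (m, t, Suc q)"
    proof -
      have "a ?x \<bullet> (Y *\<^sub>v (B\<^sup>T *\<^sub>v b ?y)) = (B\<^sup>T *\<^sub>v b ?y) \<bullet> (Y\<^sup>T *\<^sub>v a ?x)"
        using Ya[of "B\<^sup>T *\<^sub>v b ?y"] B b YTa by (simp add: comm_scalar_prod[where n = n])
      also have "\<dots> = b ?y \<bullet> (B *\<^sub>v (Y\<^sup>T *\<^sub>v a ?x))"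
        by (rule transpose_vec_mult_scalar[OF B YTa b])
      also have "\<dots> = m * (b ?y \<bullet> (Y\<^sup>T *\<^sub>v a ?x)) + b (m, t, Suc q) \<bullet> (Y\<^sup>T *\<^sub>v a ?x)"
        using dual_chain_step[OF B chB b b0 bd be _ YTa] True by simp
      also have "\<dots> = m * M ?x ?y + M ?x (m, t, Suc q)"
        unfolding M_def Ya[OF b] using comm_scalar_prod[OF b YTa] by simp
      finally show ?thesis .
    qed
    ultimately show ?thesis unfolding AYb by simp
  next
    case False
    \<comment> \<open>Beyond the end of a chain every coefficient in the recurrence vanishes.\<close>
    then have "(l, s, p) \<notin> ?I \<and> (l, s, Suc p) \<notin> ?I \<or> (m, t, q) \<notin> ?I \<and> (m, t, Suc q) \<notin> ?I"
      by auto
    then show ?thesis using M0 False by auto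
  qed
  have Mdist: "M (l, s, p) (m, t, q) = 0" if "l \<noteq> m" for l s p m t q
    using sylvester_coefficients_distinct[of l m "\<lambda>p q. M (l, s, p) (m, t, q)" "r l ! s" "r m ! t" p q]
      that rec M0 by simp
  have Mhank: "M (l, s, p) (l, t, q) = M (l, s, p + q) (l, t, 0)"
    and Mhank': "M (l, s, p) (l, t, q) = M (l, s, 0) (l, t, p + q)" for l s p t q
    using hankel_coefficients[of "\<lambda>p q. M (l, s, p) (l, t, q)" p q]
      hankel_coefficients[of "\<lambda>q p. M (l, s, p) (l, t, q)" q p] rec[of l s _ l t _]
    by (simp_all add: add.commute)
  define c where "c = (\<lambda>(l, s, t, k). M (l, s, k - 1) (l, t, 0))"
  have Mk: "M (l, s, p) (l, t, q)
      = (\<Sum>k=1..min (r l ! s) (r l ! t). c (l, s, t, k) * (if p + q + 1 = k then 1 else 0))" for l s p t q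
  proof -
    have "(\<Sum>k=1..min (r l ! s) (r l ! t). c (l, s, t, k) * (if p + q + 1 = k then 1 else 0))
      = (if p + q < min (r l ! s) (r l ! t) then M (l, s, p + q) (l, t, 0) else 0)"
      unfolding c_def by (simp add: if_distrib[where f = "\<lambda>z. _ * z"] sum.delta cong: if_cong)
    also have "\<dots> = M (l, s, p) (l, t, q)"
      using Mhank[of l s p t q] Mhank'[of l s p t q] M0[of "(l, s, p + q)" "(l, t, 0)"]
        M0[of "(l, s, 0)" "(l, t, p + q)"] by auto
    finally show ?thesis by simp
  qed
  have "Y $$ (i, j) = (\<Sum>x\<in>corner_indices S r. c x * corner_product W U x $$ (i, j))"
    if ij: "i < n" "j < n" for i j
  proof -
    have W: "W l ! s \<in> carrier_mat n (r l ! s)" and U: "U l ! s \<in> carrier_mat n (r l ! s)"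
      if "l \<in> S" "s < length (r l)" for l s
      using jordan_chain_matrices_dim[OF A chA] jordan_chain_matrices_dim[OF B chB] that by auto
    have colY: "col Y j \<in> carrier_vec n" using Y ij by auto
    have aY: "a x \<bullet> col Y j = (\<Sum>y\<in>?I. M x y * ?u y $ j)" for x
    proof -
      have YTa: "Y\<^sup>T *\<^sub>v a x \<in> carrier_vec n" using Y a by simp
      have "a x \<bullet> col Y j = (Y\<^sup>T *\<^sub>v a x) $ j"
        using Y a[of x] ij comm_scalar_prod[OF a colY] by simp
      also have "\<dots> = (\<Sum>y\<in>?I. (b y \<bullet> (Y\<^sup>T *\<^sub>v a x)) * ?u y $ j)"
        by (rule be[OF YTa ij(2)])
      also have "\<dots> = (\<Sum>y\<in>?I. M x y * ?u y $ j)"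
        unfolding M_def using comm_scalar_prod[OF b YTa] transpose_vec_mult_scalar[OF Y b a] by simp
      finally show ?thesis .
    qed
    have "Y $$ (i, j) = (\<Sum>x\<in>?I. (a x \<bullet> col Y j) * ?w x $ i)"
      using ae[OF colY ij(1)] Y ij by simp
    also have "\<dots> = (\<Sum>l\<in>S. \<Sum>s<length (r l). \<Sum>p<r l ! s. \<Sum>m\<in>S. \<Sum>t<length (r m). \<Sum>q<r m ! t.
        M (l, s, p) (m, t, q) * ?u (m, t, q) $ j * ?w (l, s, p) $ i)"
      unfolding aY sum_chain_indices[OF S] sum_distrib_right ..
    also have "\<dots> = (\<Sum>l\<in>S. \<Sum>s<length (r l). \<Sum>p<r l ! s. \<Sum>t<length (r l). \<Sum>q<r l ! t.
        M (l, s, p) (l, t, q) * ?u (l, t, q) $ j * ?w (l, s, p) $ i)"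
    proof (rule sum.cong[OF refl], rule sum.cong[OF refl], rule sum.cong[OF refl])
      fix l s p assume l: "l \<in> S"
      have "(\<Sum>m\<in>S. \<Sum>t<length (r m). \<Sum>q<r m ! t.
          M (l, s, p) (m, t, q) * ?u (m, t, q) $ j * ?w (l, s, p) $ i)
        = (\<Sum>m\<in>S. if m = l then \<Sum>t<length (r m). \<Sum>q<r m ! t.
          M (l, s, p) (m, t, q) * ?u (m, t, q) $ j * ?w (l, s, p) $ i else 0)"
        by (intro sum.cong) (auto simp: Mdist)
      then show "(\<Sum>m\<in>S. \<Sum>t<length (r m). \<Sum>q<r m ! t.
          M (l, s, p) (m, t, q) * ?u (m, t, q) $ j * ?w (l, s, p) $ i)
        = (\<Sum>t<length (r l). \<Sum>q<r l ! t. M (l, s, p) (l, t, q) * ?u (l, t, q) $ j * ?w (l, s, p) $ i)"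
        using S l by (simp add: sum.delta)
    qed
    also have "\<dots> = (\<Sum>l\<in>S. \<Sum>s<length (r l). \<Sum>t<length (r l). \<Sum>p<r l ! s. \<Sum>q<r l ! t.
        M (l, s, p) (l, t, q) * ?u (l, t, q) $ j * ?w (l, s, p) $ i)"
      by (intro sum.cong refl sum.swap)
    also have "\<dots> = (\<Sum>l\<in>S. \<Sum>s<length (r l). \<Sum>t<length (r l). \<Sum>k=1..min (r l ! s) (r l ! t).
        c (l, s, t, k) * corner_product W U (l, s, t, k) $$ (i, j))"
    proof (rule sum.cong[OF refl], rule sum.cong[OF refl], rule sum.cong[OF refl])
      fix l s t assume l: "l \<in> S" and s: "s \<in> {..<length (r l)}" and t: "t \<in> {..<length (r l)}"
      have Ws: "W l ! s \<in> carrier_mat n (r l ! s)" and Ut: "U l ! t \<in> carrier_mat n (r l ! t)"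
        using W U l s t by auto
      let ?K = "{1..min (r l ! s) (r l ! t)}"
      have "(\<Sum>p<r l ! s. \<Sum>q<r l ! t. M (l, s, p) (l, t, q) * ?u (l, t, q) $ j * ?w (l, s, p) $ i)
        = (\<Sum>p<r l ! s. \<Sum>q<r l ! t. \<Sum>k\<in>?K. c (l, s, t, k) *
            ((W l ! s) $$ (i, p) * (U l ! t) $$ (j, q) * (if p + q + 1 = k then 1 else 0)))"
        using Ws Ut ij by (intro sum.cong refl) (simp add: Mk sum_distrib_left sum_distrib_right mult_ac)
      also have "\<dots> = (\<Sum>p<r l ! s. \<Sum>k\<in>?K. \<Sum>q<r l ! t. c (l, s, t, k) *
            ((W l ! s) $$ (i, p) * (U l ! t) $$ (j, q) * (if p + q + 1 = k then 1 else 0)))"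
        by (intro sum.cong refl sum.swap)
      also have "\<dots> = (\<Sum>k\<in>?K. \<Sum>p<r l ! s. \<Sum>q<r l ! t. c (l, s, t, k) *
            ((W l ! s) $$ (i, p) * (U l ! t) $$ (j, q) * (if p + q + 1 = k then 1 else 0)))"
        by (rule sum.swap)
      also have "\<dots> = (\<Sum>k\<in>?K. c (l, s, t, k) * corner_product W U (l, s, t, k) $$ (i, j))"
        using Ws Ut corner_sandwich_index[OF Ws Ut ij] by (simp add: sum_distrib_left)
      finally show "(\<Sum>p<r l ! s. \<Sum>q<r l ! t. M (l, s, p) (l, t, q) * ?u (l, t, q) $ j * ?w (l, s, p) $ i)
        = (\<Sum>k\<in>?K. c (l, s, t, k) * corner_product W U (l, s, t, k) $$ (i, j))" .
    qed
    also have "\<dots> = (\<Sum>x\<in>corner_indices S r. c x * corner_product W U x $$ (i, j))"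
      unfolding corner_indices_def using S by (simp add: sum.Sigma split_def del: corner_product.simps)
    finally show ?thesis .
  qed
  then show ?thesis by (rule that)
qed

section \<open>From the linear matrix equation to \<open>sol\<close> and \<open>cosol\<close>\<close>

text \<open>
  With \<open>\<sigma> = 1\<close> and \<open>\<sigma> = -1\<close> this map sends \<open>W E\<^sub>k U\<^sup>T\<close> to \<open>X\<^sub>T\<close> and \<open>Y\<^sub>T\<close>, which allows both halves of
  the theorem to be proved at once.
\<close>

definition twist :: "complex \<Rightarrow> complex mat \<Rightarrow> complex mat \<Rightarrow> complex mat" where
  "twist \<sigma> J P = P * J\<^sup>T - \<sigma> \<cdot>\<^sub>m (P\<^sup>T * J)"

definition twisted_sol :: "complex \<Rightarrow> complex mat \<Rightarrow> complex mat set" where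
  "twisted_sol \<sigma> J = {X \<in> carrier_mat (dim_row J) (dim_row J).
     X\<^sup>T * J + \<sigma> \<cdot>\<^sub>m (J * X) = 0\<^sub>m (dim_row J) (dim_row J)}"

lemma one_smult_mat: "(1 :: 'a :: monoid_mult) \<cdot>\<^sub>m A = A"
  by (intro eq_matI) auto

lemma smult_smult_mat: "c \<cdot>\<^sub>m (d \<cdot>\<^sub>m A) = (c * d :: 'a :: semigroup_mult) \<cdot>\<^sub>m A"
  by (intro eq_matI) (auto simp: mult.assoc)

lemma twisted_sol_one: "twisted_sol 1 J = sol J"
  unfolding twisted_sol_def sol_def by (simp add: one_smult_mat)

lemma twisted_sol_minus_one:
  assumes J: "J \<in> carrier_mat n n"
  shows "twisted_sol (- 1) J = cosol J"
proof -
  have "X\<^sup>T * J + (- 1) \<cdot>\<^sub>m (J * X) = X\<^sup>T * J - J * X" if "X \<in> carrier_mat n n" for X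
    using that J by (intro eq_matI) auto
  then show ?thesis using J unfolding twisted_sol_def cosol_def by auto
qed

lemma transpose_smult_mat: "(c \<cdot>\<^sub>m A)\<^sup>T = c \<cdot>\<^sub>m A\<^sup>T"
  by (intro eq_matI) auto

lemma twist_carrier [simp]:
  "J \<in> carrier_mat n n \<Longrightarrow> P \<in> carrier_mat n n \<Longrightarrow> twist \<sigma> J P \<in> carrier_mat n n"
  unfolding twist_def by (intro minus_carrier_mat smult_carrier_mat mult_carrier_mat[of _ n n]) auto

lemma twist_add:
  assumes "J \<in> carrier_mat n n" and "P \<in> carrier_mat n n" and "Q \<in> carrier_mat n n"
  shows "twist \<sigma> J (P + Q) = twist \<sigma> J P + twist \<sigma> J Q"
  using assms unfolding twist_def
  by (intro eq_matI) (auto simp: scalar_prod_def sum.distrib algebra_simps)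

lemma twist_smult:
  assumes "J \<in> carrier_mat n n" and "P \<in> carrier_mat n n"
  shows "twist \<sigma> J (c \<cdot>\<^sub>m P) = c \<cdot>\<^sub>m twist \<sigma> J P"
  using assms unfolding twist_def
  by (intro eq_matI) (auto simp: scalar_prod_def sum_distrib_left algebra_simps)

lemma twisted_sol_submodule:
  assumes J: "J \<in> carrier_mat n n"
  shows "submodule class_ring (twisted_sol \<sigma> J) (module_mat TYPE(complex) n n)"
proof -
  define L where "L X = X\<^sup>T * J + \<sigma> \<cdot>\<^sub>m (J * X)" for X
  have mem: "X \<in> twisted_sol \<sigma> J \<longleftrightarrow> X \<in> carrier_mat n n \<and> L X = 0\<^sub>m n n" for X
    using J unfolding twisted_sol_def L_def by auto
  have "L (0\<^sub>m n n) = 0\<^sub>m n n"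
    using J unfolding L_def by (intro eq_matI) (auto simp: scalar_prod_def)
  moreover have "L (X + Y) = L X + L Y" if "X \<in> carrier_mat n n" "Y \<in> carrier_mat n n" for X Y
    using that J unfolding L_def
    by (intro eq_matI) (auto simp: scalar_prod_def sum.distrib algebra_simps)
  moreover have "L (c \<cdot>\<^sub>m X) = c \<cdot>\<^sub>m L X" if "X \<in> carrier_mat n n" for c X
    using that J unfolding L_def
    by (intro eq_matI) (auto simp: scalar_prod_def sum_distrib_left algebra_simps)
  moreover have "module class_ring (module_mat TYPE(complex) n n)"
    using matrix_vs[where ?'a = complex] unfolding vectorspace_def by blast
  ultimately show ?thesis
    by (intro submodule.intro) (auto simp: mem module_mat_simps)
qed

lemma backward_id_corner_carrier [simp]: "backward_id_corner k a b \<in> carrier_mat a b"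
  unfolding backward_id_corner_def by simp

lemma transpose_backward_id_corner: "(backward_id_corner k a b)\<^sup>T = backward_id_corner k b a"
  unfolding backward_id_corner_def backward_id_def by (intro eq_matI) (auto simp: add.commute)

text \<open>
  The superdiagonal of the left factor shifts the rows of \<open>E\<^sub>k\<close> up, that of the right factor shifts
  its columns to the left. Both move the antidiagonal one step towards the corner. For larger
  \<open>k\<close> the border would cut the antidiagonal off, and the two shifts would differ there.
\<close>

lemma backward_id_corner_jordan_block:
  assumes "k \<le> min a b"
  shows "jordan_block a l * backward_id_corner k a b = backward_id_corner k a b * (jordan_block b l)\<^sup>T"
proof (rule eq_matI)
  let ?E = "backward_id_corner k a b"
  have E: "?E $$ (p, q) = (if p + q + 1 = k then 1 else 0)" if "p < a" "q < b" for p q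
    using that unfolding backward_id_corner_def backward_id_def by auto
  fix p q
  assume "p < dim_row (?E * (jordan_block b l)\<^sup>T)" "q < dim_col (?E * (jordan_block b l)\<^sup>T)"
  then have pq: "p < a" "q < b" by (auto simp: backward_id_corner_def)
  have "(jordan_block a l * ?E) $$ (p, q)
    = (\<Sum>j<a. (if p = j then l else if Suc p = j then 1 else 0) * ?E $$ (j, q))"
    using pq carrier_matD[OF backward_id_corner_carrier[of k a b]]
    by (simp add: scalar_prod_def atLeast0LessThan)
  also have "\<dots> = (\<Sum>j<a. (if p = j then l * ?E $$ (p, q) else 0)) + (\<Sum>j<a. if Suc p = j then ?E $$ (Suc p, q) else 0)"
    unfolding sum.distrib[symmetric] by (intro sum.cong) auto
  also have "\<dots> = l * ?E $$ (p, q) + (if p + q + 2 = k then 1 else 0)"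
    using pq assms by (auto simp: E)
  also have "\<dots> = (\<Sum>j<b. (if q = j then l * ?E $$ (p, q) else 0)) + (\<Sum>j<b. if Suc q = j then ?E $$ (p, Suc q) else 0)"
    using pq assms by (auto simp: E)
  also have "\<dots> = (\<Sum>j<b. ?E $$ (p, j) * (if q = j then l else if Suc q = j then 1 else 0))"
    unfolding sum.distrib[symmetric] by (intro sum.cong) auto
  also have "\<dots> = (?E * (jordan_block b l)\<^sup>T) $$ (p, q)"
    using pq carrier_matD[OF backward_id_corner_carrier[of k a b]]
    by (simp add: scalar_prod_def atLeast0LessThan)
  finally show "(jordan_block a l * ?E) $$ (p, q) = (?E * (jordan_block b l)\<^sup>T) $$ (p, q)" .
qed (auto simp: backward_id_corner_def)

lemma corner_product_sylvester:
  assumes A: "A \<in> carrier_mat n n" and B: "B \<in> carrier_mat n n"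
    and W: "W \<in> carrier_mat n a" and U: "U \<in> carrier_mat n b"
    and AW: "A * W = W * jordan_block a l" and BU: "B * U = U * jordan_block b l"
    and k: "k \<le> min a b"
  shows "A * (W * backward_id_corner k a b * U\<^sup>T) = (W * backward_id_corner k a b * U\<^sup>T) * B\<^sup>T"
proof -
  let ?E = "backward_id_corner k a b"
  have E: "?E \<in> carrier_mat a b" by simp
  have Ja: "jordan_block a l \<in> carrier_mat a a" and Jb: "(jordan_block b l)\<^sup>T \<in> carrier_mat b b" by auto
  have UT: "U\<^sup>T \<in> carrier_mat b n" and BT: "B\<^sup>T \<in> carrier_mat n n" using U B by auto
  have "U\<^sup>T * B\<^sup>T = (jordan_block b l)\<^sup>T * U\<^sup>T"
    using transpose_mult[OF B U] transpose_mult[OF U, of "jordan_block b l" b] BU by simp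
  moreover have "A * (W * ?E * U\<^sup>T) = (A * W) * (?E * U\<^sup>T)"
    using assoc_mult_mat[OF A W mult_carrier_mat[OF E UT]] assoc_mult_mat[OF W E UT] by simp
  moreover have "\<dots> = W * (jordan_block a l * ?E * U\<^sup>T)"
    unfolding AW using assoc_mult_mat[OF W Ja mult_carrier_mat[OF E UT]] assoc_mult_mat[OF Ja E UT] by simp
  moreover have "\<dots> = W * (?E * ((jordan_block b l)\<^sup>T * U\<^sup>T))"
    unfolding backward_id_corner_jordan_block[OF k] using assoc_mult_mat[OF E Jb UT] by simp
  moreover have "(W * ?E * U\<^sup>T) * B\<^sup>T = W * (?E * (U\<^sup>T * B\<^sup>T))"
    using assoc_mult_mat[OF mult_carrier_mat[OF W E] UT BT]
      assoc_mult_mat[OF W E mult_carrier_mat[OF UT BT]] by simp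
  ultimately show ?thesis by simp
qed

lemma X_T_Y_T_eq_twist:
  assumes J: "J \<in> carrier_mat n n" and W: "W \<in> carrier_mat n a" and U: "U \<in> carrier_mat n b"
  shows "X_T k J W U = twist 1 J (W * backward_id_corner k a b * U\<^sup>T)"
    and "Y_T k J W U = twist (- 1) J (W * backward_id_corner k a b * U\<^sup>T)"
proof -
  let ?E = "backward_id_corner k a b"
  have E: "?E \<in> carrier_mat a b" by simp
  have WE: "W * ?E \<in> carrier_mat n b" using W E by simp
  have "(W * ?E * U\<^sup>T)\<^sup>T = U * (backward_id_corner k b a * W\<^sup>T)"
    using transpose_mult[OF WE, of "U\<^sup>T" n] transpose_mult[OF W E] U
    by (simp add: transpose_backward_id_corner)
  also have "\<dots> = U * backward_id_corner k b a * W\<^sup>T"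
    using assoc_mult_mat[OF U backward_id_corner_carrier[of k b a], of "W\<^sup>T" n] W by simp
  finally have T: "(W * ?E * U\<^sup>T)\<^sup>T = U * backward_id_corner k b a * W\<^sup>T" .
  show "X_T k J W U = twist 1 J (W * ?E * U\<^sup>T)"
    unfolding X_T_def twist_def T using W U by (simp add: one_smult_mat del: assoc_mult_mat)
  show "Y_T k J W U = twist (- 1) J (W * ?E * U\<^sup>T)"
    unfolding Y_T_def twist_def T using W U J by (intro eq_matI) (auto simp del: assoc_mult_mat)
qed

text \<open>
  The matrix \<open>K\<close> is \<open>J\<^sup>-\<^sup>T\<close>. Then \<open>C = K J\<close>, and the transpose of \<open>C\<^sup>-\<^sup>1 = J\<^sup>-\<^sup>1 J\<^sup>T\<close> is \<open>J K\<close>.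
\<close>

lemma cosquare_inverse:
  assumes J: "J \<in> carrier_mat n n" and inv: "invertible_mat J"
  obtains K where "K \<in> carrier_mat n n" and "J\<^sup>T * K = 1\<^sub>m n" and "K * J\<^sup>T = 1\<^sub>m n"
    and "cosquare J = K * J" and "(mat_inv (cosquare J))\<^sup>T = J * K"
    and "mat_inv (cosquare J) \<in> carrier_mat n n"
proof -
  have JT: "J\<^sup>T \<in> carrier_mat n n" using J by simp
  have invT: "invertible_mat J\<^sup>T"
  proof -
    obtain B where JB: "J * B = 1\<^sub>m n" and BJ: "B * J = 1\<^sub>m n" and B: "B \<in> carrier_mat n n"
      using mat_inv[OF J inv] by blast
    have "J\<^sup>T * B\<^sup>T = 1\<^sub>m n" "B\<^sup>T * J\<^sup>T = 1\<^sub>m n"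
      using arg_cong[OF BJ, of transpose_mat] arg_cong[OF JB, of transpose_mat]
        transpose_mult[OF B J] transpose_mult[OF J B] by auto
    then show ?thesis
      using J B unfolding invertible_mat_def inverts_mat_def
      by (auto intro!: exI[of _ "B\<^sup>T"])
  qed
  define K where "K = mat_inv J\<^sup>T"
  have K: "K \<in> carrier_mat n n" and JK: "J\<^sup>T * K = 1\<^sub>m n" and KJ: "K * J\<^sup>T = 1\<^sub>m n"
    unfolding K_def using mat_inv[OF JT invT] by auto
  have KT: "K\<^sup>T \<in> carrier_mat n n" using K by simp
  have JKT: "J * K\<^sup>T = 1\<^sub>m n" and KTJ: "K\<^sup>T * J = 1\<^sub>m n"
    using arg_cong[OF KJ, of transpose_mat] arg_cong[OF JK, of transpose_mat]
      transpose_mult[OF K JT] transpose_mult[OF JT K] by auto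
  define D where "D = K\<^sup>T * J\<^sup>T"
  have C: "cosquare J = K * J" unfolding cosquare_def K_def ..
  have Cc: "K * J \<in> carrier_mat n n" and Dc: "D \<in> carrier_mat n n" using K J unfolding D_def by auto
  have "K * J * D = K * (J * K\<^sup>T * J\<^sup>T)"
    unfolding D_def using assoc_mult_mat[OF K J mult_carrier_mat[OF KT JT]] assoc_mult_mat[OF J KT JT] by simp
  also have "\<dots> = 1\<^sub>m n" unfolding JKT using KJ JT by simp
  finally have CD: "K * J * D = 1\<^sub>m n" .
  then have DC: "D * (K * J) = 1\<^sub>m n" by (rule mat_mult_left_right_inverse[OF Cc Dc])
  have "invertible_mat (K * J)"
    using CD DC Cc Dc K J unfolding invertible_mat_def inverts_mat_def by (auto intro!: exI[of _ D])
  note invC = mat_inv[OF Cc this]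
  have "mat_inv (K * J) = D * (K * J) * mat_inv (K * J)" using DC invC(1) by simp
  also have "\<dots> = D" using assoc_mult_mat[OF Dc Cc invC(1)] invC(2) Dc by simp
  finally have "(mat_inv (cosquare J))\<^sup>T = J * K"
    unfolding C using transpose_mult[OF KT JT] unfolding D_def by simp
  then show ?thesis using that[OF K JK KJ C] invC(1) unfolding C by blast
qed

text \<open>
  A solution satisfies \<open>X\<^sup>T J = -\<sigma> J X\<close>. Transposing this and using it a second time gives the linear
  equation for \<open>P = X J\<^sup>-\<^sup>T\<close>, while the map \<open>twist\<close> takes this \<open>P\<close> to \<open>X + \<sigma>\<^sup>2 X = 2 X\<close>. Conversely the
  linear equation is equivalent to \<open>J P J\<^sup>T = J\<^sup>T P J\<close>, which is what makes the image of \<open>P\<close> a solution.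
\<close>

lemma twisted_sol_eq_image:
  assumes J: "J \<in> carrier_mat n n" and K: "K \<in> carrier_mat n n"
    and JK: "J\<^sup>T * K = 1\<^sub>m n" and KJ: "K * J\<^sup>T = 1\<^sub>m n" and \<sigma>: "\<sigma> * \<sigma> = 1"
  shows "twisted_sol \<sigma> J = twist \<sigma> J ` {P \<in> carrier_mat n n. (K * J) * P = P * (J * K)}"
proof -
  have JT: "J\<^sup>T \<in> carrier_mat n n" using J by simp
  have cancel: "J\<^sup>T * (K * X) = X" "K * (J\<^sup>T * X) = X" if "X \<in> carrier_mat n n" for X
    using that assoc_mult_mat[OF JT K that] assoc_mult_mat[OF K JT that] JK KJ by auto
  have assoc: "(X * Y) * Z = X * (Y * Z)"
    if "X \<in> carrier_mat n n" "Y \<in> carrier_mat n n" "Z \<in> carrier_mat n n" for X Y Z :: "complex mat"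
    using that by (rule assoc_mult_mat)
  have mem: "X \<in> twisted_sol \<sigma> J \<longleftrightarrow> X\<^sup>T * J = (- \<sigma>) \<cdot>\<^sub>m (J * X)" if X: "X \<in> carrier_mat n n" for X
  proof
    assume "X \<in> twisted_sol \<sigma> J"
    then have "X\<^sup>T * J + \<sigma> \<cdot>\<^sub>m (J * X) = 0\<^sub>m n n" using J unfolding twisted_sol_def by simp
    then have "(X\<^sup>T * J + \<sigma> \<cdot>\<^sub>m (J * X)) $$ (i, j) = 0" if "i < n" "j < n" for i j
      using that by simp
    then show "X\<^sup>T * J = (- \<sigma>) \<cdot>\<^sub>m (J * X)"
      using X J by (intro eq_matI) (auto simp: add_eq_0_iff2)
  next
    assume "X\<^sup>T * J = (- \<sigma>) \<cdot>\<^sub>m (J * X)"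
    then show "X \<in> twisted_sol \<sigma> J"
      using X J unfolding twisted_sol_def by (auto intro!: eq_matI)
  qed
  show ?thesis
  proof (intro equalityI subsetI)
    fix X assume XS: "X \<in> twisted_sol \<sigma> J"
    then have X: "X \<in> carrier_mat n n" using J unfolding twisted_sol_def by simp
    have XT: "X\<^sup>T \<in> carrier_mat n n" using X by simp
    have eq: "X\<^sup>T * J = (- \<sigma>) \<cdot>\<^sub>m (J * X)" using XS mem[OF X] by simp
    have "(X\<^sup>T * J)\<^sup>T = J\<^sup>T * X" using transpose_mult[OF XT J] by simp
    moreover have "((- \<sigma>) \<cdot>\<^sub>m (J * X))\<^sup>T = (- \<sigma>) \<cdot>\<^sub>m (X\<^sup>T * J\<^sup>T)"
      using transpose_mult[OF J X] by (simp add: transpose_smult_mat)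
    ultimately have eqT: "J\<^sup>T * X = (- \<sigma>) \<cdot>\<^sub>m (X\<^sup>T * J\<^sup>T)" using eq by simp
    define P where "P = X * K"
    have P: "P \<in> carrier_mat n n" unfolding P_def using X K by simp
    have PJ: "P * J\<^sup>T = X" unfolding P_def using assoc[OF X K JT] KJ X by simp
    have "J\<^sup>T * (P * (J * K)) = (J\<^sup>T * X) * (K * (J * K))"
      unfolding P_def using X K J JT by (simp add: assoc)
    also have "\<dots> = (- \<sigma>) \<cdot>\<^sub>m (X\<^sup>T * (J\<^sup>T * (K * (J * K))))"
      unfolding eqT using XT JT K J by (simp add: assoc mult_smult_assoc_mat[of _ n n _ n])
    also have "\<dots> = (- \<sigma>) \<cdot>\<^sub>m (X\<^sup>T * J * K)"
      using cancel(1)[of "J * K"] assoc[OF XT J K] J K by simp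
    also have "\<dots> = J * P"
      unfolding eq P_def using X K J \<sigma>
      by (simp add: assoc mult_smult_assoc_mat[of _ n n _ n] smult_smult_mat one_smult_mat)
    finally have "K * (J\<^sup>T * (P * (J * K))) = K * (J * P)" by simp
    then have syl: "(K * J) * P = P * (J * K)"
      using cancel(2)[of "P * (J * K)"] assoc[OF K J P] P J K by simp
    have "P\<^sup>T = K\<^sup>T * X\<^sup>T" unfolding P_def by (rule transpose_mult[OF X K])
    moreover have "K\<^sup>T * J = 1\<^sub>m n"
      using arg_cong[OF JK, of transpose_mat] transpose_mult[OF JT K] by simp
    moreover have KT: "K\<^sup>T \<in> carrier_mat n n" using K by simp
    ultimately have "P\<^sup>T * J = (- \<sigma>) \<cdot>\<^sub>m X"
      using assoc[OF KT XT J] assoc[OF KT J X] eq X J mult_smult_distrib[OF KT mult_carrier_mat[OF J X]]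
      by simp
    then have tw: "twist \<sigma> J P = X + X"
      unfolding twist_def PJ using X \<sigma> by (intro eq_matI) (auto simp flip: mult.assoc)
    \<comment> \<open>The factor one half undoes the doubling.\<close>
    have "X = twist \<sigma> J ((1 / 2) \<cdot>\<^sub>m P)"
      unfolding twist_smult[OF J P] tw using X by (intro eq_matI) auto
    moreover have "(K * J) * ((1 / 2) \<cdot>\<^sub>m P) = ((1 / 2) \<cdot>\<^sub>m P) * (J * K)"
      using syl mult_smult_distrib[OF mult_carrier_mat[OF K J] P]
        mult_smult_assoc_mat[OF P mult_carrier_mat[OF J K]] by simp
    ultimately show "X \<in> twist \<sigma> J ` {P \<in> carrier_mat n n. (K * J) * P = P * (J * K)}"
      using P by auto
  next
    fix X assume "X \<in> twist \<sigma> J ` {P \<in> carrier_mat n n. (K * J) * P = P * (J * K)}"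
    then obtain P where X: "X = twist \<sigma> J P" and P: "P \<in> carrier_mat n n"
      and syl: "(K * J) * P = P * (J * K)" by auto
    have PT: "P\<^sup>T \<in> carrier_mat n n" using P by simp
    have "J\<^sup>T * (K * J * P) * J\<^sup>T = J * P * J\<^sup>T"
      using cancel(1)[of "J * P"] assoc[OF K J P] J P by simp
    moreover have "J\<^sup>T * (P * (J * K)) * J\<^sup>T = J\<^sup>T * P * J"
      using P J K JT KJ by (simp add: assoc)
    ultimately have sym: "J * P * J\<^sup>T = J\<^sup>T * P * J" using syl by simp
    have "X\<^sup>T = J * P\<^sup>T - \<sigma> \<cdot>\<^sub>m (J\<^sup>T * P)"
    proof -
      have "(P * J\<^sup>T)\<^sup>T = J * P\<^sup>T" using transpose_mult[OF P JT] by simp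
      moreover have "(P\<^sup>T * J)\<^sup>T = J\<^sup>T * P" using transpose_mult[OF PT J] by simp
      ultimately show ?thesis
        unfolding X twist_def
        using transpose_minus[OF mult_carrier_mat[OF P JT] smult_carrier_mat[OF mult_carrier_mat[OF PT J]]]
        by (simp add: transpose_smult_mat)
    qed
    then have "X\<^sup>T * J = (J * P\<^sup>T) * J - \<sigma> \<cdot>\<^sub>m (J\<^sup>T * P * J)"
      using J P PT JT by (simp add: minus_mult_distrib_mat[of _ n n _ _ n] mult_smult_assoc_mat[of _ n n _ n])
    also have "\<dots> = (- \<sigma>) \<cdot>\<^sub>m (J * P * J\<^sup>T - \<sigma> \<cdot>\<^sub>m (J * (P\<^sup>T * J)))"
      unfolding sym using J P PT JT \<sigma> by (intro eq_matI) (auto simp: assoc algebra_simps simp flip: mult.assoc)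
    also have "\<dots> = (- \<sigma>) \<cdot>\<^sub>m (J * X)"
      unfolding X twist_def using J P PT JT
      by (simp add: assoc mult_minus_distrib_mat[of _ n n _ n] mult_smult_distrib[of _ n n _ n])
    finally show "X \<in> twisted_sol \<sigma> J" using mem[of X] X P J by simp
  qed
qed

lemma linear_combination_image_in_span:
  fixes T :: "complex mat \<Rightarrow> complex mat"
  assumes T: "\<And>P. P \<in> carrier_mat n n \<Longrightarrow> T P \<in> carrier_mat n n"
    and T_add: "\<And>P Q. P \<in> carrier_mat n n \<Longrightarrow> Q \<in> carrier_mat n n \<Longrightarrow> T (P + Q) = T P + T Q"
    and T_smult: "\<And>c P. P \<in> carrier_mat n n \<Longrightarrow> T (c \<cdot>\<^sub>m P) = c \<cdot>\<^sub>m T P"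
    and "finite I" and G: "G ` I \<subseteq> carrier_mat n n"
    and Y: "Y \<in> carrier_mat n n"
    and "\<And>i j. i < n \<Longrightarrow> j < n \<Longrightarrow> Y $$ (i, j) = (\<Sum>x\<in>I. c x * G x $$ (i, j))"
  shows "T Y \<in> module.span class_ring (module_mat TYPE(complex) n n) (T ` G ` I)"
proof -
  let ?V = "module_mat TYPE(complex) n n"
  let ?S = "module.span class_ring ?V (T ` G ` I)"
  interpret matrix_vs n n "TYPE(complex)" .
  have TG: "T ` G ` I \<subseteq> carrier_mat n n" using T G by auto
  note sub = span_is_submodule[OF TG]
  have "T Z \<in> ?S" if "finite H" and "H \<subseteq> I" and "Z \<in> carrier_mat n n"
    and "\<And>i j. i < n \<Longrightarrow> j < n \<Longrightarrow> Z $$ (i, j) = (\<Sum>x\<in>H. c x * G x $$ (i, j))" for H Z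
    using that
  proof (induction H arbitrary: Z)
    case empty
    then have "Z = 0 \<cdot>\<^sub>m Z" by (intro eq_matI) auto
    then have "T Z = 0 \<cdot>\<^sub>m T Z" using T_smult[OF empty.prems(2), of 0] by simp
    also have "\<dots> = 0\<^sub>m n n" using T[OF empty.prems(2)] by (intro eq_matI) auto
    finally show ?case using submodule.zero_closed[OF sub] by (simp add: module_mat_simps)
  next
    case (insert x H)
    have Gx: "G x \<in> carrier_mat n n" using insert.prems(1) G by auto
    define R where "R = mat n n (\<lambda>(i, j). \<Sum>x\<in>H. c x * G x $$ (i, j))"
    have R: "R \<in> carrier_mat n n" unfolding R_def by simp
    have TR: "T R \<in> ?S" by (rule insert.IH) (use insert.prems in \<open>auto simp: R_def\<close>)
    have TGx: "T (G x) \<in> ?S" using in_own_span[OF TG] insert.prems(1) by auto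
    have "Z = c x \<cdot>\<^sub>m G x + R"
      using insert Gx unfolding R_def by (intro eq_matI) auto
    then have "T Z = c x \<cdot>\<^sub>m T (G x) + T R"
      using T_add[OF smult_carrier_mat[OF Gx] R] T_smult[OF Gx] by simp
    then show ?case
      using submodule.m_closed[OF sub] submodule.smult_closed[OF sub] TR TGx
      by (simp add: module_mat_simps)
  qed
  then show ?thesis using assms by blast
qed

lemma span_twist_corner_products:
  assumes J: "J \<in> carrier_mat n n" and inv: "invertible_mat J" and \<sigma>: "\<sigma> * \<sigma> = 1"
    and C: "C = cosquare J"
    and r: "\<And>l. l \<in> spectrum C \<Longrightarrow> jordan_block_sizes C l (r l)"
    and W: "\<And>l. l \<in> spectrum C \<Longrightarrow> jordan_chain_matrices C l (r l) (W l)"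
    and U: "\<And>l. l \<in> spectrum C \<Longrightarrow> jordan_chain_matrices (mat_inv C) l (r l) (U l)"
  shows "module.span class_ring (module_mat TYPE(complex) n n)
      (twist \<sigma> J ` corner_product W U ` corner_indices (spectrum C) r) = twisted_sol \<sigma> J"
proof -
  let ?I = "corner_indices (spectrum C) r"
  let ?D = "mat_inv C"
  obtain K where K: "K \<in> carrier_mat n n" and JK: "J\<^sup>T * K = 1\<^sub>m n" and KJ: "K * J\<^sup>T = 1\<^sub>m n"
    and CK: "C = K * J" and DT: "?D\<^sup>T = J * K" and D: "?D \<in> carrier_mat n n"
    using cosquare_inverse[OF J inv] C by metis
  have Cc: "C \<in> carrier_mat n n" unfolding CK using K J by simp
  note image = twisted_sol_eq_image[OF J K JK KJ \<sigma>, folded CK DT]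
  have finS: "finite (spectrum C)" using card_finite_spectrum[OF Cc] by simp
  then have finI: "finite ?I" unfolding corner_indices_def by (intro finite_SigmaI) auto
  have G: "corner_product W U x \<in> carrier_mat n n \<and> C * corner_product W U x = corner_product W U x * ?D\<^sup>T"
    if x: "x \<in> ?I" for x
  proof -
    obtain l s t k where xe: "x = (l, s, t, k)" by (cases x)
    have l: "l \<in> spectrum C" "s < length (r l)" "t < length (r l)" "k \<le> min (r l ! s) (r l ! t)"
      using x unfolding xe corner_indices_def by auto
    have Ws: "W l ! s \<in> carrier_mat n (r l ! s)" and AW: "C * W l ! s = W l ! s * jordan_block (r l ! s) l"
      using W[OF l(1)] l(2) Cc unfolding jordan_chain_matrices_def by auto
    have Ut: "U l ! t \<in> carrier_mat n (r l ! t)" and BU: "?D * U l ! t = U l ! t * jordan_block (r l ! t) l"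
      using U[OF l(1)] l(3) D unfolding jordan_chain_matrices_def by auto
    show ?thesis
      using corner_product_sylvester[OF Cc D Ws Ut AW BU l(4)] Ws Ut
        mult_carrier_mat[OF mult_carrier_mat[OF Ws backward_id_corner_carrier], of "(U l ! t)\<^sup>T"]
      unfolding xe by simp
  qed
  interpret matrix_vs n n "TYPE(complex)" .
  have "span (twist \<sigma> J ` corner_product W U ` ?I) \<subseteq> twisted_sol \<sigma> J"
    by (rule span_is_subset[OF _ twisted_sol_submodule[OF J]]) (use G in \<open>auto simp: image\<close>)
  moreover have "twisted_sol \<sigma> J \<subseteq> span (twist \<sigma> J ` corner_product W U ` ?I)"
  proof
    fix X assume "X \<in> twisted_sol \<sigma> J"
    then obtain P where X: "X = twist \<sigma> J P" and P: "P \<in> carrier_mat n n" and syl: "C * P = P * ?D\<^sup>T"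
      unfolding image by auto
    obtain c where c: "\<And>i j. i < n \<Longrightarrow> j < n \<Longrightarrow>
        P $$ (i, j) = (\<Sum>x\<in>?I. c x * corner_product W U x $$ (i, j))"
      using sylvester_solution_expansion[OF Cc D finS card_chain_indices[OF Cc r] W U P syl] by blast
    show "X \<in> span (twist \<sigma> J ` corner_product W U ` ?I)"
      unfolding X
      by (rule linear_combination_image_in_span[where c = c])
        (use J P finI G c in \<open>auto simp: twist_add[OF J] twist_smult[OF J]\<close>)
  qed
  ultimately show ?thesis by (rule equalityI)
qed

lemma B_T_eq_twist:
  assumes J: "J \<in> carrier_mat n n" and C: "C \<in> carrier_mat n n" "C = cosquare J"
    and D: "D \<in> carrier_mat n n"
    and W: "\<And>l. l \<in> spectrum C \<Longrightarrow> jordan_chain_matrices C l (r l) (W l)"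
    and U: "\<And>l. l \<in> spectrum C \<Longrightarrow> jordan_chain_matrices D l (r l) (U l)"
  shows "B_T_plus J r W U = twist 1 J ` corner_product W U ` corner_indices (spectrum C) r"
    and "B_T_minus J r W U = twist (- 1) J ` corner_product W U ` corner_indices (spectrum C) r"
proof -
  let ?f = "\<lambda>\<sigma> (l, s, t, k). twist \<sigma> J (corner_product W U (l, s, t, k))"
  have XY: "X_T k J (W l ! s) (U l ! t) = ?f 1 (l, s, t, k)" "Y_T k J (W l ! s) (U l ! t) = ?f (- 1) (l, s, t, k)"
    if "l \<in> spectrum C" "s < length (r l)" "t < length (r l)" for l s t k
    using X_T_Y_T_eq_twist[OF J jordan_chain_matrices_dim[OF C(1) W that(2)] jordan_chain_matrices_dim[OF D U that(3)]]
      jordan_chain_matrices_dim[OF C(1) W that(2)] jordan_chain_matrices_dim[OF D U that(3)] that(1)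
    by auto
  have im: "twist \<sigma> J ` corner_product W U ` corner_indices (spectrum C) r =
    (\<Union>l\<in>spectrum C. \<Union>s<length (r l). \<Union>t<length (r l). \<Union>k\<in>{1..min (r l ! s) (r l ! t)}. {?f \<sigma> (l, s, t, k)})" for \<sigma>
    unfolding corner_indices_def by (force simp: image_iff)
  show "B_T_plus J r W U = twist 1 J ` corner_product W U ` corner_indices (spectrum C) r"
    unfolding B_T_plus_def im C(2)[symmetric] by (intro SUP_cong refl) (simp add: XY)
  show "B_T_minus J r W U = twist (- 1) J ` corner_product W U ` corner_indices (spectrum C) r"
    unfolding B_T_minus_def im C(2)[symmetric] by (intro SUP_cong refl) (simp add: XY)
qed

theorem theorem2p8:
  fixes n :: nat and J C :: "complex mat"
    and r :: "complex \<Rightarrow> nat list"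
    and W U :: "complex \<Rightarrow> complex mat list"
  assumes "J \<in> carrier_mat n n"
    and "invertible_mat J"
    and "C = cosquare J"
    and "\<And>l. l \<in> spectrum C \<Longrightarrow> jordan_block_sizes C l (r l)"
    and "\<And>l. l \<in> spectrum C \<Longrightarrow> jordan_chain_matrices C l (r l) (W l)"
    and "\<And>l. l \<in> spectrum C \<Longrightarrow> jordan_chain_matrices (mat_inv C) l (r l) (U l)"
  shows "module.span class_ring (module_mat TYPE(complex) n n) (B_T_plus J r W U) = sol J
    \<and> module.span class_ring (module_mat TYPE(complex) n n) (B_T_minus J r W U) = cosol J"
proof -
  obtain K where "K \<in> carrier_mat n n" and "C = K * J" and D: "mat_inv C \<in> carrier_mat n n"
    using cosquare_inverse[OF assms(1,2)] assms(3) by metis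
  then have C: "C \<in> carrier_mat n n" using assms(1) by simp
  have B: "B_T_plus J r W U = twist 1 J ` corner_product W U ` corner_indices (spectrum C) r"
    "B_T_minus J r W U = twist (- 1) J ` corner_product W U ` corner_indices (spectrum C) r"
    by (rule B_T_eq_twist[OF assms(1) C assms(3) D assms(5,6)]; assumption)+
  show ?thesis
    using span_twist_corner_products[OF assms(1,2) _ assms(3-6), of 1]
      span_twist_corner_products[OF assms(1,2) _ assms(3-6), of "- 1"]
    unfolding B twisted_sol_one twisted_sol_minus_one[OF assms(1)] by simp
qed

end
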